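(* Let $\mathbb{G}$ be a compact quantum group. Then $\mathcal{P}^\infty(\mathbb{G})=\mathcal{AP}(C_0(\mathbb{G}))$.
   Context: $\mathbb{G}$ is a compact quantum group, viewed as a locally compact quantum group (Kustermans–Vaes) for which the reduced C$^*$-algebra $C_0(\mathbb{G})$ is unital (so $C_0(\mathbb{G})=C(\mathbb{G})=M(C_0(\mathbb{G}))$). $L^\infty(\mathbb{G})=C(\mathbb{G})''$ (on the GNS space of the Haar state) with coproduct $\Delta:L^\infty(\mathbb{G})\to L^\infty(\mathbb{G})\overline\otimes L^\infty(\mathbb{G})$. $\mathcal{P}^\infty(\mathbb{G})$ is the set of $x\in L^\infty(\mathbb{G})$ such that $\Delta(x)$ is a finite-rank tensor (lies in the algebraic tensor product $L^\infty(\mathbb{G})\odot L^\infty(\mathbb{G})$). A (finite-dimensional) corepresentation of $C_0(\mathbb{G})$ is $U=(U_{ij})\in\mathbb{M}_n(M(C_0(\mathbb{G})))$ with $\Delta(U_{ij})=\sum_kU_{ik}\otimes U_{kj}$; it is admissible if both $U$ and $U^\top=(U_{ji})$ are invertible. $\mathcal{AP}(C_0(\mathbb{G}))$ is the set of all elements of linear spans of the entries $U_{ij}$ of admissible corepresentations of $C_0(\mathbb{G})$. *)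

theory Defs
  imports "HOL-Analysis.Analysis"
begin

section \<open>Complex Hilbert spaces\<close>

text \<open>The inner product is linear in the first variable. The axiom on
  \<open>norm\<close> also gives positive definiteness.\<close>

class chilbert_space = banach +
  fixes scaleC :: "complex \<Rightarrow> 'a \<Rightarrow> 'a" (infixr "*\<^sub>C" 75)
    and cinner :: "'a \<Rightarrow> 'a \<Rightarrow> complex"
  assumes scaleC_add_right: "c *\<^sub>C (x + y) = c *\<^sub>C x + c *\<^sub>C y"
    and scaleC_add_left: "(c + d) *\<^sub>C x = c *\<^sub>C x + d *\<^sub>C x"
    and scaleC_scaleC: "c *\<^sub>C (d *\<^sub>C x) = (c * d) *\<^sub>C x"
    and scaleR_scaleC: "r *\<^sub>R x = complex_of_real r *\<^sub>C x"
    and cinner_add_left: "cinner (x + y) z = cinner x z + cinner y z"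
    and cinner_scaleC_left: "cinner (c *\<^sub>C x) y = c * cinner x y"
    and cinner_commute: "cinner x y = cnj (cinner y x)"
    and cinner_self: "cinner x x = complex_of_real ((norm x)\<^sup>2)"

lemma norm_scaleC: "norm (c *\<^sub>C x) = cmod c * norm (x :: 'a::chilbert_space)"
proof -
  have "cinner (c *\<^sub>C x) (c *\<^sub>C x) = c * cnj (c * cinner x x)"
    by (metis cinner_scaleC_left cinner_commute)
  also have "\<dots> = complex_of_real ((cmod c * norm x)\<^sup>2)"
    by (simp add: cinner_self power_mult_distrib flip: complex_norm_square)
  finally have "(norm (c *\<^sub>C x))\<^sup>2 = (cmod c * norm x)\<^sup>2"
    by (simp only: cinner_self of_real_eq_iff)
  then show ?thesis
    by (simp add: power2_eq_iff_nonneg)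
qed

lemma scaleC_one: "1 *\<^sub>C x = (x :: 'a::chilbert_space)"
  using scaleR_scaleC[of 1 x] by simp

lemma module_scaleC: "module (scaleC :: complex \<Rightarrow> 'a::chilbert_space \<Rightarrow> 'a)"
  by unfold_locales (simp_all add: scaleC_add_right scaleC_add_left scaleC_scaleC scaleC_one)

lemma bounded_linear_scaleC: "bounded_linear (\<lambda>x :: 'a::chilbert_space. c *\<^sub>C x)"
  by (rule bounded_linear_intro[where K = "cmod c"])
    (simp_all add: scaleC_add_right scaleR_scaleC scaleC_scaleC norm_scaleC mult.commute)


section \<open>Bounded operators\<close>

text \<open>The library type \<open>'h \<Rightarrow>\<^sub>L 'h\<close> consists of the real-linear bounded maps;
  \<open>bop\<close> is the algebra \<open>B(H)\<close> of the complex-linear ones, with the same operator norm.\<close>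

definition bop :: "('h::chilbert_space \<Rightarrow>\<^sub>L 'h) set" where
  "bop = {T :: 'h \<Rightarrow>\<^sub>L 'h. \<forall>c \<xi>. T (c *\<^sub>C \<xi>) = c *\<^sub>C T \<xi>}"

lift_definition scale_op :: "complex \<Rightarrow> ('h::chilbert_space \<Rightarrow>\<^sub>L 'h) \<Rightarrow> ('h \<Rightarrow>\<^sub>L 'h)"
  is "\<lambda>c T \<xi>. c *\<^sub>C T \<xi>"
  by (rule bounded_linear_compose[OF bounded_linear_scaleC])

lemma module_scale_op: "module (scale_op :: complex \<Rightarrow> ('h::chilbert_space \<Rightarrow>\<^sub>L 'h) \<Rightarrow> _)"
  by unfold_locales
    (transfer, simp add: scaleC_add_right scaleC_add_left scaleC_scaleC scaleC_one)+

abbreviation cspan :: "'h::chilbert_space set \<Rightarrow> 'h set" where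
  "cspan \<equiv> module.span scaleC"

abbreviation cspan_op :: "('h::chilbert_space \<Rightarrow>\<^sub>L 'h) set \<Rightarrow> ('h \<Rightarrow>\<^sub>L 'h) set" where
  "cspan_op \<equiv> module.span scale_op"

definition adj :: "('h::chilbert_space \<Rightarrow>\<^sub>L 'h) \<Rightarrow> ('h \<Rightarrow>\<^sub>L 'h)" where
  "adj T = (THE S :: 'h \<Rightarrow>\<^sub>L 'h. \<forall>\<xi> \<eta>. cinner (T \<xi>) \<eta> = cinner \<xi> (S \<eta>))"

definition commutant :: "('h::chilbert_space \<Rightarrow>\<^sub>L 'h) set \<Rightarrow> ('h \<Rightarrow>\<^sub>L 'h) set" where
  "commutant S = {T \<in> bop. \<forall>s\<in>S. T o\<^sub>L s = s o\<^sub>L T}"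

definition unital_cstar_algebra :: "('h::chilbert_space \<Rightarrow>\<^sub>L 'h) set \<Rightarrow> bool" where
  "unital_cstar_algebra A \<longleftrightarrow>
     A \<subseteq> bop \<and> closed A \<and> id_blinfun \<in> A \<and>
     (\<forall>a\<in>A. \<forall>b\<in>A. a + b \<in> A \<and> a o\<^sub>L b \<in> A) \<and>
     (\<forall>c. \<forall>a\<in>A. scale_op c a \<in> A) \<and> (\<forall>a\<in>A. adj a \<in> A)"

text \<open>The ultraweak (\<open>\<sigma>\<close>-weak) topology: the initial topology for the functionals
  \<open>T \<mapsto> \<Sum>n. \<langle>T \<xi>\<^sub>n, \<eta>\<^sub>n\<rangle>\<close> with square-summable \<open>\<xi>\<close> and \<open>\<eta>\<close>.\<close>

definition ultraweak_topology :: "('h::chilbert_space \<Rightarrow>\<^sub>L 'h) topology" where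
  "ultraweak_topology = topology_generated_by
     {{T :: 'h \<Rightarrow>\<^sub>L 'h. (\<Sum>n. cinner (T (\<xi> n)) (\<eta> n)) \<in> V} | \<xi> \<eta> V.
        summable (\<lambda>n::nat. (norm (\<xi> n))\<^sup>2) \<and> summable (\<lambda>n. (norm (\<eta> n))\<^sup>2) \<and> open V}"

definition normal_unital_star_hom ::
  "('h::chilbert_space \<Rightarrow>\<^sub>L 'h) set \<Rightarrow> ('k::chilbert_space \<Rightarrow>\<^sub>L 'k) set \<Rightarrow>
     (('h \<Rightarrow>\<^sub>L 'h) \<Rightarrow> ('k \<Rightarrow>\<^sub>L 'k)) \<Rightarrow> bool" where
  "normal_unital_star_hom M N \<Phi> \<longleftrightarrow>
     \<Phi> ` M \<subseteq> N \<and> \<Phi> id_blinfun = id_blinfun \<and>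
     (\<forall>x\<in>M. \<forall>y\<in>M. \<Phi> (x + y) = \<Phi> x + \<Phi> y \<and> \<Phi> (x o\<^sub>L y) = \<Phi> x o\<^sub>L \<Phi> y) \<and>
     (\<forall>c. \<forall>x\<in>M. \<Phi> (scale_op c x) = scale_op c (\<Phi> x)) \<and>
     (\<forall>x\<in>M. \<Phi> (adj x) = adj (\<Phi> x)) \<and>
     continuous_map (subtopology ultraweak_topology M) ultraweak_topology \<Phi>"


section \<open>Tensor products\<close>

text \<open>\<open>hilbert_tensor t\<close> says that the type \<open>'c\<close>, with elementary tensors \<open>t \<xi> \<eta>\<close>, is the
  Hilbert space tensor product of \<open>'a\<close> and \<open>'b\<close>; this determines \<open>'c\<close> up to a unique
  unitary respecting elementary tensors.\<close>

definition hilbert_tensor ::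
  "('a::chilbert_space \<Rightarrow> 'b::chilbert_space \<Rightarrow> 'c::chilbert_space) \<Rightarrow> bool" where
  "hilbert_tensor t \<longleftrightarrow>
     (\<forall>\<xi> \<xi>' \<eta>. t (\<xi> + \<xi>') \<eta> = t \<xi> \<eta> + t \<xi>' \<eta>) \<and>
     (\<forall>\<xi> \<eta> \<eta>'. t \<xi> (\<eta> + \<eta>') = t \<xi> \<eta> + t \<xi> \<eta>') \<and>
     (\<forall>c \<xi> \<eta>. t (c *\<^sub>C \<xi>) \<eta> = c *\<^sub>C t \<xi> \<eta> \<and> t \<xi> (c *\<^sub>C \<eta>) = c *\<^sub>C t \<xi> \<eta>) \<and>
     (\<forall>\<xi> \<eta> \<xi>' \<eta>'. cinner (t \<xi> \<eta>) (t \<xi>' \<eta>') = cinner \<xi> \<xi>' * cinner \<eta> \<eta>') \<and>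
     closure (cspan {t \<xi> \<eta> | \<xi> \<eta>. True}) = UNIV"

definition op_tensor ::
  "('a::chilbert_space \<Rightarrow> 'b::chilbert_space \<Rightarrow> 'c::chilbert_space) \<Rightarrow>
     ('a \<Rightarrow>\<^sub>L 'a) \<Rightarrow> ('b \<Rightarrow>\<^sub>L 'b) \<Rightarrow> ('c \<Rightarrow>\<^sub>L 'c)" where
  "op_tensor t a b = (THE T :: 'c \<Rightarrow>\<^sub>L 'c. T \<in> bop \<and> (\<forall>\<xi> \<eta>. T (t \<xi> \<eta>) = t (a \<xi>) (b \<eta>)))"

definition alg_tensor ::
  "('a::chilbert_space \<Rightarrow> 'b::chilbert_space \<Rightarrow> 'c::chilbert_space) \<Rightarrow>
     ('a \<Rightarrow>\<^sub>L 'a) set \<Rightarrow> ('b \<Rightarrow>\<^sub>L 'b) set \<Rightarrow> ('c \<Rightarrow>\<^sub>L 'c) set" where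
  "alg_tensor t M N = cspan_op {op_tensor t a b | a b. a \<in> M \<and> b \<in> N}"

definition min_tensor ::
  "('a::chilbert_space \<Rightarrow> 'b::chilbert_space \<Rightarrow> 'c::chilbert_space) \<Rightarrow>
     ('a \<Rightarrow>\<^sub>L 'a) set \<Rightarrow> ('b \<Rightarrow>\<^sub>L 'b) set \<Rightarrow> ('c \<Rightarrow>\<^sub>L 'c) set" where
  "min_tensor t A B = closure (alg_tensor t A B)"

definition vn_tensor ::
  "('a::chilbert_space \<Rightarrow> 'b::chilbert_space \<Rightarrow> 'c::chilbert_space) \<Rightarrow>
     ('a \<Rightarrow>\<^sub>L 'a) set \<Rightarrow> ('b \<Rightarrow>\<^sub>L 'b) set \<Rightarrow> ('c \<Rightarrow>\<^sub>L 'c) set" where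
  "vn_tensor t M N = commutant (commutant (alg_tensor t M N))"

text \<open>\<open>\<Phi> = \<Delta> \<otimes> id\<close>, resp. \<open>\<Psi> = id \<otimes> \<Delta>\<close>, as normal \<open>*\<close>-homomorphisms from \<open>M \<otimes> M\<close> (with
  elementary tensors \<open>t\<close>) to \<open>(M \<otimes> M) \<otimes> M\<close> (tensors \<open>tL\<close>), resp. \<open>M \<otimes> (M \<otimes> M)\<close>
  (tensors \<open>tR\<close>). Normality and the values on elementary tensors determine them
  on the von Neumann tensor product.\<close>

definition is_tensor_id_right where
  "is_tensor_id_right t tL M \<Delta> \<Phi> \<longleftrightarrow>
     normal_unital_star_hom (vn_tensor t M M) (vn_tensor tL (vn_tensor t M M) M) \<Phi> \<and>
     (\<forall>a\<in>M. \<forall>b\<in>M. \<Phi> (op_tensor t a b) = op_tensor tL (\<Delta> a) b)"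

definition is_tensor_id_left where
  "is_tensor_id_left t tR M \<Delta> \<Psi> \<longleftrightarrow>
     normal_unital_star_hom (vn_tensor t M M) (vn_tensor tR M (vn_tensor t M M)) \<Psi> \<and>
     (\<forall>a\<in>M. \<forall>b\<in>M. \<Psi> (op_tensor t a b) = op_tensor tR a (\<Delta> b))"


section \<open>Compact quantum groups in reduced form\<close>

definition L_infty :: "('h::chilbert_space \<Rightarrow>\<^sub>L 'h) set \<Rightarrow> ('h \<Rightarrow>\<^sub>L 'h) set" where
  "L_infty A = commutant (commutant A)"

definition haar :: "'h::chilbert_space \<Rightarrow> ('h \<Rightarrow>\<^sub>L 'h) \<Rightarrow> complex" where
  "haar \<Omega> x = cinner (x \<Omega>) \<Omega>"

text \<open>\<open>A = C(\<G>)\<close> acts on the GNS space \<open>'h\<close> of the Haar state, whose cyclic vector is \<open>\<Omega>\<close>;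
  \<open>\<Delta>\<close> is the coproduct of \<open>L\<^sup>\<infinity>(\<G>) = C(\<G>)''\<close>. The types \<open>'k\<close> and \<open>'l\<close> are \<open>'h \<otimes> 'h\<close> and
  \<open>'h \<otimes> 'h \<otimes> 'h\<close>, the latter seen through both bracketings.
  Invariance \<open>(h \<otimes> id)\<Delta>(x) = h(x)1 = (id \<otimes> h)\<Delta>(x)\<close> is tested on
  matrix coefficients, \<open>h\<close> being the vector state of \<open>\<Omega>\<close>.\<close>

locale compact_quantum_group =
  fixes t :: "'h::chilbert_space \<Rightarrow> 'h \<Rightarrow> 'k::chilbert_space"
    and tL :: "'k \<Rightarrow> 'h \<Rightarrow> 'l::chilbert_space"
    and tR :: "'h \<Rightarrow> 'k \<Rightarrow> 'l"
    and A :: "('h \<Rightarrow>\<^sub>L 'h) set"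
    and \<Omega> :: 'h
    and \<Delta> :: "('h \<Rightarrow>\<^sub>L 'h) \<Rightarrow> ('k \<Rightarrow>\<^sub>L 'k)"
  assumes tensor: "hilbert_tensor t" "hilbert_tensor tL" "hilbert_tensor tR"
    and tensor_assoc: "tL (t \<xi> \<eta>) \<zeta> = tR \<xi> (t \<eta> \<zeta>)"
    and algebra_C: "unital_cstar_algebra A"
    and coproduct: "normal_unital_star_hom (L_infty A) (vn_tensor t (L_infty A) (L_infty A)) \<Delta>"
    and coassociative: "\<exists>\<Phi> \<Psi>. is_tensor_id_right t tL (L_infty A) \<Delta> \<Phi> \<and>
          is_tensor_id_left t tR (L_infty A) \<Delta> \<Psi> \<and> (\<forall>x\<in>L_infty A. \<Phi> (\<Delta> x) = \<Psi> (\<Delta> x))"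
    and coproduct_C: "\<Delta> ` A \<subseteq> min_tensor t A A"
    and cancellation_left:
      "closure (cspan_op {\<Delta> a o\<^sub>L op_tensor t b id_blinfun | a b. a \<in> A \<and> b \<in> A}) = min_tensor t A A"
    and cancellation_right:
      "closure (cspan_op {\<Delta> a o\<^sub>L op_tensor t id_blinfun b | a b. a \<in> A \<and> b \<in> A}) = min_tensor t A A"
    and state: "norm \<Omega> = 1"
    and cyclic: "closure {blinfun_apply a \<Omega> | a. a \<in> A} = UNIV"
    and faithful: "x \<in> L_infty A \<Longrightarrow> haar \<Omega> (adj x o\<^sub>L x) = 0 \<Longrightarrow> x = 0"
    and left_invariant: "x \<in> L_infty A \<Longrightarrow>
          cinner (\<Delta> x (t \<xi> \<Omega>)) (t \<eta> \<Omega>) = haar \<Omega> x * cinner \<xi> \<eta>"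
    and right_invariant: "x \<in> L_infty A \<Longrightarrow>
          cinner (\<Delta> x (t \<Omega> \<xi>)) (t \<Omega> \<eta>) = haar \<Omega> x * cinner \<xi> \<eta>"


section \<open>Finite-rank tensors and admissible corepresentations\<close>

definition P_infty where
  "P_infty t A \<Delta> = {x \<in> L_infty A. \<Delta> x \<in> alg_tensor t (L_infty A) (L_infty A)}"

text \<open>Matrices in \<open>M\<^sub>n(A)\<close> are families indexed by \<open>i, j < n\<close>; values outside are ignored.\<close>

definition invertible_matrix ::
  "('h::chilbert_space \<Rightarrow>\<^sub>L 'h) set \<Rightarrow> nat \<Rightarrow> (nat \<Rightarrow> nat \<Rightarrow> 'h \<Rightarrow>\<^sub>L 'h) \<Rightarrow> bool" where
  "invertible_matrix A n U \<longleftrightarrow>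
     (\<exists>V. \<forall>i<n. \<forall>j<n. V i j \<in> A \<and>
        (\<Sum>k<n. U i k o\<^sub>L V k j) = (if i = j then id_blinfun else 0) \<and>
        (\<Sum>k<n. V i k o\<^sub>L U k j) = (if i = j then id_blinfun else 0))"

text \<open>The corepresentations have entries in \<open>M(C\<^sub>0(\<G>))\<close>, which is \<open>A\<close> since \<open>A\<close> is unital.\<close>

definition corepresentation where
  "corepresentation t A \<Delta> n U \<longleftrightarrow>
     (\<forall>i<n. \<forall>j<n. U i j \<in> A \<and> \<Delta> (U i j) = (\<Sum>k<n. op_tensor t (U i k) (U k j)))"

definition admissible where
  "admissible t A \<Delta> n U \<longleftrightarrow> corepresentation t A \<Delta> n U \<and>
     invertible_matrix A n U \<and> invertible_matrix A n (\<lambda>i j. U j i)"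

definition AP where
  "AP t A \<Delta> = cspan_op {U i j | U i j n. admissible t A \<Delta> n U \<and> i < n \<and> j < n}"

end

theory Submission
  imports Defs "Jordan_Normal_Form.Determinant"
begin

text \<open>
  The inclusion of \<open>AP\<close> in \<open>P_infty\<close> is immediate. For the converse let \<open>x \<in> L\<^sup>\<infinity>\<close> and write
  \<open>\<Delta>(x) = \<Sum>k. a\<^sub>k \<otimes> b\<^sub>k\<close> with the least possible number of terms, so that both families are
  linearly independent. Slicing the coassociativity identity gives a matrix \<open>c\<close> over \<open>L\<^sup>\<infinity>\<close> with
  \<open>\<Delta>(a\<^sub>m) = \<Sum>j. a\<^sub>j \<otimes> c\<^sub>j\<^sub>m\<close>, \<open>\<Delta>(b\<^sub>m) = \<Sum>k. c\<^sub>m\<^sub>k \<otimes> b\<^sub>k\<close> and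
  \<open>\<Delta>(c\<^sub>i\<^sub>j) = \<Sum>k. c\<^sub>i\<^sub>k \<otimes> c\<^sub>k\<^sub>j\<close>.

  Independence makes the rows and the columns of \<open>c\<close> linearly independent. By faithfulness of the Haar
  state \<open>h\<close> the scalar matrices \<open>P = h(c\<^sup>* c)\<close> and \<open>Q = h(c c\<^sup>*)\<close> are then invertible, and
  invariance gives \<open>P = c\<^sup>* P c\<close> and \<open>Q = c Q c\<^sup>*\<close>; hence \<open>c\<close> is invertible. The same argument
  for the entrywise adjoint of \<open>c\<close> shows that the transpose is invertible. The entries of \<open>c\<close> lie in
  \<open>C(\<G>)\<close> because they are obtained from slices of \<open>\<Delta>(y)\<close> with \<open>y \<in> C(\<G>)\<close>. Finally \<open>a c\<^sup>-\<^sup>1\<close> and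
  \<open>c\<^sup>-\<^sup>1 b\<close> are scalar vectors \<open>z\<close> and \<open>w\<close> by invariance, so \<open>\<Delta>(x) = \<Delta>(z c w)\<close>, and \<open>\<Delta>\<close> is
  injective.
\<close>

section \<open>Hilbert space operators and their adjoints\<close>

interpretation hs: Modules.module "scaleC :: complex \<Rightarrow> 'a::chilbert_space \<Rightarrow> 'a"
  by (rule module_scaleC)

interpretation ops: Modules.module "scale_op :: complex \<Rightarrow> ('a::chilbert_space \<Rightarrow>\<^sub>L 'a) \<Rightarrow> _"
  by (rule module_scale_op)

section \<open>Sesquilinear calculus, Cauchy-Schwarz and the Riesz representation theorem\<close>

lemma cinner_add_right: "cinner z (x + y) = cinner z x + cinner z (y :: 'a::chilbert_space)"
  by (metis cinner_commute cinner_add_left complex_cnj_add)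

lemma cinner_scaleC_right: "cinner x (c *\<^sub>C y) = cnj c * cinner x (y :: 'a::chilbert_space)"
  by (metis cinner_commute cinner_scaleC_left complex_cnj_mult)

lemma cinner_zero_left [simp]: "cinner 0 (x :: 'a::chilbert_space) = 0"
  using cinner_add_left[of 0 0 x] by simp

lemma cinner_zero_right [simp]: "cinner (x :: 'a::chilbert_space) 0 = 0"
  using cinner_add_right[of x 0 0] by simp

lemma cinner_minus_left: "cinner (- x) y = - cinner x (y :: 'a::chilbert_space)"
  using cinner_add_left[of x "-x" y] by (simp add: eq_neg_iff_add_eq_0 add.commute)

lemma cinner_minus_right: "cinner x (- y) = - cinner x (y :: 'a::chilbert_space)"
  using cinner_add_right[of x y "-y"] by (simp add: eq_neg_iff_add_eq_0 add.commute)

lemma cinner_diff_left: "cinner (x - z) y = cinner x y - cinner z (y :: 'a::chilbert_space)"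
  using cinner_add_left[of x "-z" y] by (simp add: cinner_minus_left)

lemma cinner_diff_right: "cinner x (y - z) = cinner x y - cinner x (z :: 'a::chilbert_space)"
  using cinner_add_right[of x y "-z"] by (simp add: cinner_minus_right)

lemma cinner_sum_left: "cinner (sum f I) y = (\<Sum>i\<in>I. cinner (f i) (y :: 'a::chilbert_space))"
  by (induction I rule: infinite_finite_induct) (simp_all add: cinner_add_left)

lemma cinner_sum_right: "cinner x (sum f I) = (\<Sum>i\<in>I. cinner x (f i :: 'a::chilbert_space))"
  by (induction I rule: infinite_finite_induct) (simp_all add: cinner_add_right)

lemmas cinner_simps = cinner_add_left cinner_add_right cinner_scaleC_left cinner_scaleC_right
  cinner_diff_left cinner_diff_right cinner_minus_left cinner_minus_right
  cinner_sum_left cinner_sum_right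

lemma cinner_self_eq_0 [simp]: "cinner x x = 0 \<longleftrightarrow> x = (0 :: 'a::chilbert_space)"
  by (simp add: cinner_self)

lemma norm_sq_Re_cinner: "(norm x)\<^sup>2 = Re (cinner x (x :: 'a::chilbert_space))"
  by (simp add: cinner_self)

lemma cinner_eqI:
  assumes "\<And>z. cinner x z = cinner y (z :: 'a::chilbert_space)"
  shows "x = y"
proof -
  have "cinner (x - y) (x - y) = 0"
    by (subst cinner_diff_left) (simp add: assms)
  then show ?thesis by simp
qed

text \<open>Pythagoras for the component of \<open>x\<close> orthogonal to \<open>y\<close>.
  Nonnegativity of the left side is Cauchy-Schwarz; minimality of a norm against it gives the
  orthogonality in \<open>riesz\<close>.\<close>

lemma norm_sq_diff_scaled:
  fixes x y :: "'a::chilbert_space"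
  assumes "y \<noteq> 0"
  shows "(norm (x - (cinner x y / complex_of_real ((norm y)\<^sup>2)) *\<^sub>C y))\<^sup>2
    = (norm x)\<^sup>2 - (cmod (cinner x y))\<^sup>2 / (norm y)\<^sup>2"
proof -
  define c where "c = cinner x y / complex_of_real ((norm y)\<^sup>2)"
  have ny: "complex_of_real ((norm y)\<^sup>2) \<noteq> 0" using assms by simp
  have c: "c * cinner y y = cinner x y" using ny by (simp only: c_def cinner_self) simp
  have "cinner (x - c *\<^sub>C y) (x - c *\<^sub>C y)
      = cinner x x - cnj c * cinner x y - c * cnj (cinner x y) + cnj c * (c * cinner y y)"
    by (simp add: cinner_simps algebra_simps cinner_commute[of y x])
  also have "\<dots> = cinner x x - c * cnj (cinner x y)" unfolding c by simp
  also have "c * cnj (cinner x y) = complex_of_real ((cmod (cinner x y))\<^sup>2 / (norm y)\<^sup>2)"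
    unfolding c_def by (simp only: of_real_divide complex_norm_square times_divide_eq_left)
  finally have "complex_of_real ((norm (x - c *\<^sub>C y))\<^sup>2) =
      complex_of_real ((norm x)\<^sup>2 - (cmod (cinner x y))\<^sup>2 / (norm y)\<^sup>2)"
    by (simp only: cinner_self of_real_diff)
  then show ?thesis unfolding c_def of_real_eq_iff .
qed

lemma cinner_Cauchy_Schwarz: "cmod (cinner x y) \<le> norm x * norm (y :: 'a::chilbert_space)"
proof (cases "y = 0")
  case False
  have "0 \<le> (norm x)\<^sup>2 - (cmod (cinner x y))\<^sup>2 / (norm y)\<^sup>2"
    by (metis norm_sq_diff_scaled[OF False] zero_le_power2)
  then have "(cmod (cinner x y))\<^sup>2 \<le> (norm x * norm y)\<^sup>2"
    using False by (simp add: divide_simps power_mult_distrib)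
  then show ?thesis by (rule power2_le_imp_le) simp
qed simp

lemma bounded_linear_cinner_right: "bounded_linear (\<lambda>y. cinner (x :: 'a::chilbert_space) y)"
  by (rule bounded_linear_intro[where K = "norm x"])
    (simp_all add: cinner_simps scaleR_scaleC cinner_Cauchy_Schwarz scaleR_conv_of_real
      mult.commute[of _ "norm x"])

lemma parallelogram_law:
  "(norm (x + y))\<^sup>2 + (norm (x - y))\<^sup>2 = 2 * (norm x)\<^sup>2 + 2 * (norm (y :: 'a::chilbert_space))\<^sup>2"
  by (simp add: norm_sq_Re_cinner cinner_simps)

text \<open>The affine hyperplane \<open>f = 1\<close> is closed and convex, so it has a point
  \<open>z\<close> of least norm; \<open>z\<close> is orthogonal to the kernel of \<open>f\<close>,
  and a rescaling of \<open>z\<close> represents \<open>f\<close>.\<close>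

lemma riesz:
  fixes f :: "'a::chilbert_space \<Rightarrow> complex"
  assumes bl: "bounded_linear f" and homog: "\<And>c x. f (c *\<^sub>C x) = c * f x"
  shows "\<exists>z. \<forall>x. f x = cinner x z"
proof (cases "\<forall>x. f x = 0")
  case True
  then show ?thesis by (intro exI[of _ 0]) simp
next
  case False
  interpret f: bounded_linear f by fact
  from False obtain x0 where x0: "f x0 \<noteq> 0" by blast
  define C where "C = {x. f x = 1}"
  have cl: "closed C"
    unfolding C_def by (intro closed_Collect_eq f.continuous_on continuous_intros)
  have "(1 / f x0) *\<^sub>C x0 \<in> C" using x0 by (simp add: C_def homog)
  then have ne: "C \<noteq> {}" by blast
  define d where "d = Inf (norm ` C)"
  have bdd: "bdd_below (norm ` C)" by (rule bdd_belowI[of _ 0]) auto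
  have dle: "d \<le> norm x" if "x \<in> C" for x
    unfolding d_def by (rule cInf_lower) (use that bdd in auto)
  have d0: "0 \<le> d" unfolding d_def by (rule cInf_greatest) (use ne in auto)
  have "\<exists>x\<in>C. norm x < d + 1 / real (Suc n)" for n
  proof -
    have "Inf (norm ` C) < d + 1 / real (Suc n)" by (simp add: d_def)
    then show ?thesis using ne by (auto simp: cInf_less_iff bdd)
  qed
  then obtain X where X: "\<And>n. X n \<in> C" "\<And>n. norm (X n) < d + 1 / real (Suc n)" by metis
  \<comment> \<open>The midpoint of \<open>x\<close> and \<open>y\<close> lies in \<open>C\<close>,
    so its norm is at least \<open>d\<close>; the parallelogram law then bounds the distance, which
    makes minimizing sequences Cauchy.\<close>
  have close: "(norm (x - y))\<^sup>2 \<le> 2 * (norm x)\<^sup>2 + 2 * (norm y)\<^sup>2 - 4 * d\<^sup>2"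
    if "x \<in> C" "y \<in> C" for x y
  proof -
    have "(1/2) *\<^sub>R (x + y) \<in> C" using that by (simp add: C_def f.scaleR f.add scaleR_conv_of_real)
    from dle[OF this] have "2 * d \<le> norm (x + y)" by simp
    then have "(2 * d)\<^sup>2 \<le> (norm (x + y))\<^sup>2" using d0 by (intro power_mono) auto
    then show ?thesis using parallelogram_law[of x y] by simp
  qed
  have lim: "(\<lambda>n. d + 1 / real (Suc n)) \<longlonglongrightarrow> d"
    using tendsto_add[OF tendsto_const[of d] LIMSEQ_Suc[OF lim_1_over_n]] by simp
  have nX: "(\<lambda>n. norm (X n)) \<longlonglongrightarrow> d"
    by (rule tendsto_sandwich[OF _ _ tendsto_const lim])
      (use dle X in \<open>auto intro!: always_eventually less_imp_le\<close>)
  have "Cauchy X"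
  proof (rule metric_CauchyI)
    fix e :: real assume e: "0 < e"
    have "(\<lambda>n. (norm (X n))\<^sup>2) \<longlonglongrightarrow> d\<^sup>2" by (intro tendsto_power nX)
    \<comment> \<open>With this margin \<open>close\<close> bounds the squared distance by four
      times \<open>e\<^sup>2 / 4\<close>.\<close>
    moreover have "d\<^sup>2 < d\<^sup>2 + e\<^sup>2 / 4" using e by simp
    ultimately have "\<forall>\<^sub>F n in sequentially. (norm (X n))\<^sup>2 < d\<^sup>2 + e\<^sup>2 / 4"
      by (rule order_tendstoD)
    then obtain N where N: "\<And>n. n \<ge> N \<Longrightarrow> (norm (X n))\<^sup>2 < d\<^sup>2 + e\<^sup>2 / 4"
      by (auto simp: eventually_sequentially)
    show "\<exists>M. \<forall>m\<ge>M. \<forall>n\<ge>M. dist (X m) (X n) < e"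
    proof (intro exI allI impI)
      fix m n assume "N \<le> m" "N \<le> n"
      then have "(norm (X m - X n))\<^sup>2 < e\<^sup>2"
        using close[OF X(1) X(1), of m n] N[of m] N[of n] by simp
      then show "dist (X m) (X n) < e" unfolding dist_norm
        by (rule power2_less_imp_less) (use e in simp)
    qed
  qed
  then obtain z where z: "X \<longlonglongrightarrow> z" by (auto simp: Cauchy_convergent_iff convergent_def)
  have zC: "z \<in> C" by (rule closed_sequentially[OF cl _ z]) (use X in auto)
  have nz: "norm z = d" by (rule LIMSEQ_unique[OF tendsto_norm[OF z] nX])
  have fz: "f z = 1" using zC by (simp add: C_def)
  \<comment> \<open>Translating \<open>z\<close> along the kernel stays in \<open>C\<close>, so
    removing its component along \<open>y\<close> cannot shorten it.\<close>
  have orth: "cinner z y = 0" if "f y = 0" for y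
  proof (cases "y = 0")
    case False
    let ?c = "cinner z y / complex_of_real ((norm y)\<^sup>2)"
    have "z - ?c *\<^sub>C y \<in> C" using that by (simp add: C_def f.diff homog fz)
    from dle[OF this] have "(norm z)\<^sup>2 \<le> (norm (z - ?c *\<^sub>C y))\<^sup>2"
      using nz d0 by (intro power_mono) auto
    then have "(cmod (cinner z y))\<^sup>2 / (norm y)\<^sup>2 \<le> 0"
      using norm_sq_diff_scaled[OF False, of z] by linarith
    then show ?thesis using False by (simp add: divide_le_0_iff)
  qed simp
  have "f x = cinner x ((1 / cinner z z) *\<^sub>C z)" for x
  proof -
    have zz: "cinner z z \<noteq> 0" using fz f.zero by auto
    have "cinner z (x - f x *\<^sub>C z) = 0" by (rule orth) (simp add: f.diff homog fz)
    then have "cinner (x - f x *\<^sub>C z) z = 0" by (subst cinner_commute) simp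
    then have "cinner x z = f x * cinner z z" by (simp add: cinner_simps)
    moreover have "cnj (cinner z z) = cinner z z" by (simp add: cinner_self)
    ultimately show ?thesis using zz by (simp add: cinner_simps)
  qed
  then show ?thesis by blast
qed

lemma bop_scaleC: "T \<in> bop \<Longrightarrow> T (c *\<^sub>C \<xi>) = c *\<^sub>C T \<xi>"
  by (simp add: bop_def)

lemma op_eqI:
  fixes S T :: "'a::real_normed_vector \<Rightarrow>\<^sub>L 'b::chilbert_space"
  assumes "\<And>\<alpha> \<beta>. cinner (S \<alpha>) \<beta> = cinner (T \<alpha>) \<beta>"
  shows "S = T"
  by (intro blinfun_eqI cinner_eqI assms)

text \<open>Adjoints and slices are both obtained from here. Riesz is applied in the second
  variable, where \<open>B\<close> is conjugate-linear; hence the passage to the conjugate of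
  \<open>B\<close>.\<close>

lemma bop_of_form:
  fixes B :: "'a::chilbert_space \<Rightarrow> 'a \<Rightarrow> complex"
  assumes "\<And>x y z. B (x + y) z = B x z + B y z" "\<And>c x z. B (c *\<^sub>C x) z = c * B x z"
    and "\<And>x y z. B z (x + y) = B z x + B z y" "\<And>c x z. B z (c *\<^sub>C x) = cnj c * B z x"
    and bound: "\<And>x y. cmod (B x y) \<le> K * norm x * norm y"
  shows "\<exists>T\<in>bop. \<forall>x y. cinner (T x) y = B x y"
proof -
  \<comment> \<open>The bound itself forces \<open>K\<close> to be nonnegative as soon as a nonzero
    vector exists.\<close>
  have K: "0 \<le> K" if "x \<noteq> 0" for x :: 'a
  proof -
    have "0 \<le> K * norm x * norm x" using bound[of x x] norm_ge_zero by (rule order_trans[rotated])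
    then show ?thesis using that by (simp add: zero_le_mult_iff)
  qed
  have "\<exists>z. \<forall>y. cnj (B x y) = cinner y z" for x
  proof (rule riesz)
    show "bounded_linear (\<lambda>y. cnj (B x y))"
      by (rule bounded_linear_intro[where K = "K * norm x"])
        (simp_all add: assms scaleR_scaleC scaleR_conv_of_real order_trans[OF bound] mult_ac)
  qed (simp add: assms)
  then obtain T where T: "\<And>x y. cinner y (T x) = cnj (B x y)" by metis
  have T': "cinner (T x) y = B x y" for x y by (subst cinner_commute) (simp add: T)
  have sc: "T (c *\<^sub>C x) = c *\<^sub>C T x" for c x
    by (rule cinner_eqI) (simp add: T' cinner_simps assms)
  have nT: "norm (T x) \<le> norm x * K" for x
  proof (cases "T x = 0")
    case True
    then show ?thesis using K by (cases "x = 0") auto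
  next
    case False
    have "(norm (T x))\<^sup>2 = cmod (B x (T x))" by (simp add: T'[symmetric] cinner_self norm_power)
    also have "\<dots> \<le> K * norm x * norm (T x)" by (rule bound)
    finally show ?thesis using False by (simp add: power2_eq_square mult.commute)
  qed
  have bl: "bounded_linear T"
    by (rule bounded_linear_intro[OF _ _ nT])
      (rule cinner_eqI, simp add: T' cinner_simps assms scaleR_scaleC)+
  show ?thesis
    by (rule bexI[of _ "Blinfun T"])
      (simp_all add: bop_def bounded_linear_Blinfun_apply[OF bl] sc T')
qed

lemma adj_exists:
  fixes T :: "'a::chilbert_space \<Rightarrow>\<^sub>L 'a"
  assumes "T \<in> bop"
  shows "\<exists>S\<in>bop. \<forall>\<xi> \<eta>. cinner (T \<xi>) \<eta> = cinner \<xi> (S \<eta>)"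
proof -
  have "\<exists>S\<in>bop. \<forall>x y. cinner (blinfun_apply S x) y = cinner x (T y)"
  proof (rule bop_of_form[where K = "norm T"])
    fix x y :: 'a
    have "cmod (cinner x (T y)) \<le> norm x * norm (T y)" by (rule cinner_Cauchy_Schwarz)
    also have "\<dots> \<le> norm x * (norm T * norm y)" by (intro mult_left_mono norm_blinfun) simp
    finally show "cmod (cinner x (T y)) \<le> norm T * norm x * norm y" by (simp add: mult_ac)
  qed (simp_all add: cinner_simps blinfun.add_right bop_scaleC[OF assms])
  then show ?thesis by (metis cinner_commute)
qed

text \<open>The inner product separates vectors, so the definite description in \<open>adj\<close>
  has at most one candidate; the algebraic rules for \<open>adj\<close> then reduce to checking the
  adjoint relation.\<close>

lemma adj_unique:
  fixes S T :: "'a::chilbert_space \<Rightarrow>\<^sub>L 'a"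
  assumes "\<And>\<xi> \<eta>. cinner (T \<xi>) \<eta> = cinner \<xi> (S \<eta>)"
  shows "adj T = S"
  unfolding adj_def
proof (rule the_equality)
  fix S' :: "'a \<Rightarrow>\<^sub>L 'a" assume "\<forall>\<xi> \<eta>. cinner (T \<xi>) \<eta> = cinner \<xi> (S' \<eta>)"
  then show "S' = S" by (intro op_eqI) (metis assms cinner_commute)
qed (use assms in blast)

lemma
  fixes T :: "'a::chilbert_space \<Rightarrow>\<^sub>L 'a"
  assumes "T \<in> bop"
  shows adj_bop [simp, intro]: "adj T \<in> bop"
    and cinner_adj_right: "cinner \<xi> (adj T \<eta>) = cinner (T \<xi>) \<eta>"
proof -
  from adj_exists[OF assms] obtain S
    where S: "S \<in> bop" "\<And>\<xi> \<eta>. cinner (T \<xi>) \<eta> = cinner \<xi> (S \<eta>)" by blast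
  with adj_unique[of T S] have "adj T = S" by blast
  with S show "adj T \<in> bop" "cinner \<xi> (adj T \<eta>) = cinner (T \<xi>) \<eta>" by simp_all
qed

lemma cinner_adj_left: "T \<in> bop \<Longrightarrow> cinner (adj T \<xi>) \<eta> = cinner \<xi> (T \<eta>)"
  by (metis cinner_adj_right cinner_commute)

section \<open>The algebra of bounded operators and rules for adjoints\<close>

lemma scale_op_apply [simp]: "scale_op c T \<xi> = c *\<^sub>C T \<xi>"
  by (simp add: scale_op.rep_eq)

lemma id_bop [simp, intro]: "id_blinfun \<in> bop"
  by (simp add: bop_def)

lemma zero_bop [simp, intro]: "0 \<in> bop"
  by (simp add: bop_def)

lemma add_bop: "S \<in> bop \<Longrightarrow> T \<in> bop \<Longrightarrow> S + T \<in> bop"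
  by (simp add: bop_def blinfun.add_left scaleC_add_right)

lemma sum_bop: "(\<And>i. i \<in> I \<Longrightarrow> T i \<in> bop) \<Longrightarrow> sum T I \<in> bop"
  by (induction I rule: infinite_finite_induct) (simp_all add: add_bop)

lemma comp_bop: "S \<in> bop \<Longrightarrow> T \<in> bop \<Longrightarrow> S o\<^sub>L T \<in> bop"
  by (simp add: bop_def)

lemma scale_bop: "T \<in> bop \<Longrightarrow> scale_op c T \<in> bop"
  by (simp add: bop_def scaleC_scaleC mult.commute)

lemma adj_adj [simp]: "T \<in> bop \<Longrightarrow> adj (adj T) = T"
  by (rule adj_unique) (simp add: cinner_adj_left)

lemma adj_id [simp]: "adj id_blinfun = id_blinfun"
  by (rule adj_unique) simp

lemma adj_zero [simp]: "adj 0 = 0"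
  by (rule adj_unique) simp

lemma adj_add: "S \<in> bop \<Longrightarrow> T \<in> bop \<Longrightarrow> adj (S + T) = adj S + adj T"
  by (rule adj_unique) (simp add: blinfun.add_left cinner_simps cinner_adj_right)

lemma adj_sum: "(\<And>i. i \<in> I \<Longrightarrow> T i \<in> bop) \<Longrightarrow> adj (sum T I) = (\<Sum>i\<in>I. adj (T i))"
  by (induction I rule: infinite_finite_induct) (simp_all add: adj_add sum_bop)

lemma adj_comp: "S \<in> bop \<Longrightarrow> T \<in> bop \<Longrightarrow> adj (S o\<^sub>L T) = adj T o\<^sub>L adj S"
  by (rule adj_unique) (simp add: cinner_adj_right)

lemma adj_scale: "T \<in> bop \<Longrightarrow> adj (scale_op c T) = scale_op (cnj c) (adj T)"
  by (rule adj_unique) (simp add: cinner_simps cinner_adj_right)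

lemma scale_op_comp_left: "scale_op c S o\<^sub>L T = scale_op c (S o\<^sub>L T)"
  by (rule blinfun_eqI) simp

lemma scale_op_comp_right: "S \<in> bop \<Longrightarrow> S o\<^sub>L scale_op c T = scale_op c (S o\<^sub>L T)"
  by (rule blinfun_eqI) (simp add: bop_scaleC)

lemmas comp_add_left = bounded_bilinear.add_left[OF bounded_bilinear_blinfun_compose]
  and comp_add_right = bounded_bilinear.add_right[OF bounded_bilinear_blinfun_compose]
  and comp_sum_left = bounded_bilinear.sum_left[OF bounded_bilinear_blinfun_compose]
  and comp_sum_right = bounded_bilinear.sum_right[OF bounded_bilinear_blinfun_compose]

lemma comp_assoc: "(R o\<^sub>L S) o\<^sub>L T = R o\<^sub>L (S o\<^sub>L (T :: 'a::real_normed_vector \<Rightarrow>\<^sub>L 'b::real_normed_vector))"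
  by (rule blinfun_eqI) simp

lemma comp_id_left [simp]: "id_blinfun o\<^sub>L T = T"
  by (rule blinfun_eqI) simp

lemma comp_id_right [simp]: "T o\<^sub>L id_blinfun = T"
  by (rule blinfun_eqI) simp


section \<open>Tensor products of operators\<close>

definition orthonormal_upto :: "nat \<Rightarrow> (nat \<Rightarrow> 'a::chilbert_space) \<Rightarrow> bool" where
  "orthonormal_upto m e \<longleftrightarrow> (\<forall>i<m. \<forall>j<m. cinner (e i) (e j) = (if i = j then 1 else 0))"

text \<open>The orthonormal family may be shorter than the given one. The expansions are what
  matters: they let the second legs in a finite sum of tensors be replaced by orthonormal
  vectors.\<close>

lemma gram_schmidt:
  fixes \<eta> :: "nat \<Rightarrow> 'a::chilbert_space"
  shows "\<exists>m e c. orthonormal_upto m e \<and> (\<forall>i<n. \<eta> i = (\<Sum>k<m. c i k *\<^sub>C e k))"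
proof (induction n)
  case 0
  show ?case by (rule exI[of _ 0]) (simp add: orthonormal_upto_def)
next
  case (Suc n)
  then obtain m :: nat and e :: "nat \<Rightarrow> 'a" and c where e: "orthonormal_upto m e" and c: "\<And>i. i < n \<Longrightarrow> \<eta> i = (\<Sum>k<m. c i k *\<^sub>C e k)"
    by blast
  \<comment> \<open>The residual of the new vector: if it vanishes the family stays as it is,
    otherwise its normalization is appended.\<close>
  define r where "r = \<eta> n - (\<Sum>k<m. cinner (\<eta> n) (e k) *\<^sub>C e k)"
  have r: "cinner r (e j) = 0" if "j < m" for j
  proof -
    have "cinner r (e j) = cinner (\<eta> n) (e j) - (\<Sum>k<m. cinner (\<eta> n) (e k) * cinner (e k) (e j))"
      by (simp add: r_def cinner_simps)
    also have "(\<Sum>k<m. cinner (\<eta> n) (e k) * cinner (e k) (e j))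
        = (\<Sum>k<m. if k = j then cinner (\<eta> n) (e j) else 0)"
      by (rule sum.cong) (use e that in \<open>auto simp: orthonormal_upto_def\<close>)
    finally show ?thesis using that by simp
  qed
  have \<eta>n: "\<eta> n = (\<Sum>k<m. cinner (\<eta> n) (e k) *\<^sub>C e k) + r" by (simp add: r_def)
  show ?case
  proof (cases "r = 0")
    case True
    define c' where "c' = c(n := \<lambda>k. cinner (\<eta> n) (e k))"
    have "\<eta> i = (\<Sum>k<m. c' i k *\<^sub>C e k)" if "i < Suc n" for i
      using that c \<eta>n True by (auto simp: c'_def less_Suc_eq)
    with e show ?thesis by blast
  next
    case False
    define s where "s = complex_of_real (norm r)"
    define e' where "e' = e(m := (1 / s) *\<^sub>C r)"
    \<comment> \<open>Earlier vectors get coefficient 0 at the new index, so the longer sum leaves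
      their expansions unchanged.\<close>
    define c' where "c' = (\<lambda>i. if i = n then (\<lambda>k. cinner (\<eta> n) (e k))(m := s) else (c i)(m := 0))"
    have s: "s \<noteq> 0" "cnj s = s" "cinner r r = s * s"
      using False by (simp_all add: s_def cinner_self power2_eq_square)
    have r': "cinner (e j) r = 0" if "j < m" for j
      using r[OF that] by (subst cinner_commute) simp
    have "orthonormal_upto (Suc m) e'"
      using e s r r' by (auto simp: orthonormal_upto_def e'_def less_Suc_eq cinner_simps)
    moreover have "\<eta> i = (\<Sum>k<Suc m. c' i k *\<^sub>C e' k)" if "i < Suc n" for i
    proof (cases "i = n")
      case True
      have "(\<Sum>k<Suc m. c' i k *\<^sub>C e' k) = (\<Sum>k<m. cinner (\<eta> n) (e k) *\<^sub>C e k) + r"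
        using s True by (simp add: c'_def e'_def scaleC_scaleC scaleC_one)
      then show ?thesis using \<eta>n True by simp
    next
      case False
      then show ?thesis using that c by (simp add: c'_def e'_def)
    qed
    ultimately show ?thesis by blast
  qed
qed

section \<open>Calculus of elementary tensors\<close>

locale htensor =
  fixes t :: "'a::chilbert_space \<Rightarrow> 'b::chilbert_space \<Rightarrow> 'c::chilbert_space"
  assumes ht: "hilbert_tensor t"
begin

lemma add_left: "t (\<xi> + \<xi>') \<eta> = t \<xi> \<eta> + t \<xi>' \<eta>"
  and add_right: "t \<xi> (\<eta> + \<eta>') = t \<xi> \<eta> + t \<xi> \<eta>'"
  and scale_left: "t (c *\<^sub>C \<xi>) \<eta> = c *\<^sub>C t \<xi> \<eta>"
  and scale_right: "t \<xi> (c *\<^sub>C \<eta>) = c *\<^sub>C t \<xi> \<eta>"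
  and cinner_t: "cinner (t \<xi> \<eta>) (t \<xi>' \<eta>') = cinner \<xi> \<xi>' * cinner \<eta> \<eta>'"
  and dense: "closure (cspan {t \<xi> \<eta> | \<xi> \<eta>. True}) = UNIV"
  using ht by (simp_all add: hilbert_tensor_def)

lemma zero_left [simp]: "t 0 \<eta> = 0"
  using add_left[of 0 0] by simp

lemma zero_right [simp]: "t \<xi> 0 = 0"
  using add_right[of _ 0 0] by simp

lemma sum_left: "t (sum f I) \<eta> = (\<Sum>i\<in>I. t (f i) \<eta>)"
  by (induction I rule: infinite_finite_induct) (simp_all add: add_left)

lemma sum_right: "t \<xi> (sum f I) = (\<Sum>i\<in>I. t \<xi> (f i))"
  by (induction I rule: infinite_finite_induct) (simp_all add: add_right)

lemma norm_t: "norm (t \<xi> \<eta>) = norm \<xi> * norm \<eta>"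
proof -
  have "complex_of_real ((norm (t \<xi> \<eta>))\<^sup>2) = complex_of_real ((norm \<xi> * norm \<eta>)\<^sup>2)"
    by (simp only: cinner_self[symmetric] cinner_t) (simp add: cinner_self power_mult_distrib)
  then have "(norm (t \<xi> \<eta>))\<^sup>2 = (norm \<xi> * norm \<eta>)\<^sup>2" by (simp only: of_real_eq_iff)
  then show ?thesis by (simp add: power2_eq_iff_nonneg)
qed

text \<open>Transfers results about the first leg to the second.\<close>

lemma hilbert_tensor_flip: "hilbert_tensor (\<lambda>\<eta> \<xi>. t \<xi> \<eta>)"
proof -
  have "{t \<xi> \<eta> | \<eta> \<xi>. True} = {t \<xi> \<eta> | \<xi> \<eta>. True}" by blast
  then show ?thesis using ht by (simp add: hilbert_tensor_def mult.commute)
qed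

lemma eq_zero_of_cinner_tensors:
  assumes "\<And>\<xi> \<eta>. cinner u (t \<xi> \<eta>) = 0"
  shows "u = 0"
proof -
  have "closed {v. cinner u v = 0}"
    by (intro closed_Collect_eq linear_continuous_on bounded_linear_cinner_right continuous_intros)
  moreover have "cspan {t \<xi> \<eta> | \<xi> \<eta>. True} \<subseteq> {v. cinner u v = 0}"
    by (rule hs.span_minimal) (auto simp: assms hs.subspace_def cinner_simps)
  ultimately have "closure (cspan {t \<xi> \<eta> | \<xi> \<eta>. True}) \<subseteq> {v. cinner u v = 0}"
    by (rule closure_minimal[rotated])
  then have "cinner u u = 0" unfolding dense by blast
  then show ?thesis by simp
qed

text \<open>Density is used twice: the coefficients determine the images of elementary tensors, and
  these determine a bounded operator. Identities for \<open>\<Delta>\<close> are later checked on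
  coefficients in this way.\<close>

lemma tensor_op_eqI:
  assumes "S \<in> bop" "T \<in> bop"
    and eq: "\<And>\<xi> \<eta> \<xi>' \<eta>'. cinner (S (t \<xi> \<eta>)) (t \<xi>' \<eta>') = cinner (T (t \<xi> \<eta>)) (t \<xi>' \<eta>')"
  shows "S = T"
proof -
  have *: "S (t \<xi> \<eta>) = T (t \<xi> \<eta>)" for \<xi> \<eta>
    using eq_zero_of_cinner_tensors[of "S (t \<xi> \<eta>) - T (t \<xi> \<eta>)"] eq
    by (simp add: cinner_simps)
  have "closed {v. S v = T v}"
    by (intro closed_Collect_eq continuous_intros)
  moreover have "cspan {t \<xi> \<eta> | \<xi> \<eta>. True} \<subseteq> {v. S v = T v}"
    by (rule hs.span_minimal)
      (auto simp: * hs.subspace_def blinfun.add_right bop_scaleC[OF assms(1)] bop_scaleC[OF assms(2)])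
  ultimately have "closure (cspan {t \<xi> \<eta> | \<xi> \<eta>. True}) \<subseteq> {v. S v = T v}"
    by (rule closure_minimal[rotated])
  then show ?thesis unfolding dense by (auto intro: blinfun_eqI)
qed

lemma span_tensors_repr:
  assumes "u \<in> cspan {t \<xi> \<eta> | \<xi> \<eta>. True}"
  obtains n :: nat and \<xi> \<eta> where "u = (\<Sum>i<n. t (\<xi> i) (\<eta> i))"
proof -
  from assms have "\<exists>(n::nat) \<xi> \<eta>. u = (\<Sum>i<n. t (\<xi> i) (\<eta> i))"
  proof (induction rule: hs.span_induct_alt)
    case base
    show ?case by (rule exI[of _ 0]) simp
  next
    case (step c x y)
    then obtain n :: nat and \<xi> \<eta> \<alpha> \<beta> where
      "y = (\<Sum>i<n. t (\<xi> i) (\<eta> i))" "x = t \<alpha> \<beta>" by blast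
    then have "c *\<^sub>C x + y = (\<Sum>i<Suc n. t ((\<xi>(n := c *\<^sub>C \<alpha>)) i) ((\<eta>(n := \<beta>)) i))"
      by (simp add: scale_left)
    then show ?case by blast
  qed
  then show ?thesis using that by blast
qed

lemma norm_sum_orthonormal:
  assumes "orthonormal_upto m e"
  shows "(norm (\<Sum>k<m. t (\<zeta> k) (e k)))\<^sup>2 = (\<Sum>k<m. (norm (\<zeta> k))\<^sup>2)"
proof -
  have "cinner (\<Sum>k<m. t (\<zeta> k) (e k)) (\<Sum>k<m. t (\<zeta> k) (e k))
      = (\<Sum>k<m. \<Sum>l<m. cinner (\<zeta> k) (\<zeta> l) * cinner (e k) (e l))"
    by (simp add: cinner_simps cinner_t) (rule sum.swap)
  also have "\<dots> = (\<Sum>k<m. \<Sum>l<m. if l = k then cinner (\<zeta> k) (\<zeta> k) else 0)"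
    by (intro sum.cong refl) (use assms in \<open>auto simp: orthonormal_upto_def\<close>)
  also have "\<dots> = (\<Sum>k<m. cinner (\<zeta> k) (\<zeta> k))" by simp
  finally have "complex_of_real ((norm (\<Sum>k<m. t (\<zeta> k) (e k)))\<^sup>2)
      = complex_of_real (\<Sum>k<m. (norm (\<zeta> k))\<^sup>2)"
    by (simp only: cinner_self of_real_sum)
  then show ?thesis by (simp only: of_real_eq_iff)
qed

text \<open>Once the second legs are expanded in an orthonormal family, the sum becomes orthogonal
  and the estimate holds term by term. This bound is what makes \<open>a \<otimes> 1\<close> well
  defined and bounded.\<close>

lemma norm_amplification_le:
  fixes a :: "'a \<Rightarrow>\<^sub>L 'a" and n :: nat
  assumes a: "a \<in> bop"
  shows "norm (\<Sum>i<n. t (a (\<xi> i)) (\<eta> i)) \<le> norm a * norm (\<Sum>i<n. t (\<xi> i) (\<eta> i))"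
proof -
  obtain m e c where e: "orthonormal_upto m e"
    and c: "\<And>i. i < n \<Longrightarrow> \<eta> i = (\<Sum>k<m. c i k *\<^sub>C e k)"
    using gram_schmidt[of n \<eta>] by blast
  define \<zeta> where "\<zeta> k = (\<Sum>i<n. c i k *\<^sub>C \<xi> i)" for k
  have rew: "(\<Sum>i<n. t (f i) (\<eta> i)) = (\<Sum>k<m. t (\<Sum>i<n. c i k *\<^sub>C f i) (e k))" for f
  proof -
    have "(\<Sum>i<n. t (f i) (\<eta> i)) = (\<Sum>i<n. \<Sum>k<m. c i k *\<^sub>C t (f i) (e k))"
      by (intro sum.cong refl) (simp add: c sum_right scale_right)
    also have "\<dots> = (\<Sum>k<m. \<Sum>i<n. c i k *\<^sub>C t (f i) (e k))" by (rule sum.swap)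
    finally show ?thesis by (simp add: sum_left scale_left)
  qed
  have a\<zeta>: "(\<Sum>i<n. c i k *\<^sub>C a (\<xi> i)) = a (\<zeta> k)" for k
    by (simp add: \<zeta>_def blinfun.sum_right bop_scaleC[OF a])
  have "(norm (\<Sum>k<m. t (a (\<zeta> k)) (e k)))\<^sup>2 = (\<Sum>k<m. (norm (a (\<zeta> k)))\<^sup>2)"
    by (rule norm_sum_orthonormal[OF e])
  also have "\<dots> \<le> (\<Sum>k<m. (norm a * norm (\<zeta> k))\<^sup>2)"
    by (intro sum_mono power_mono norm_blinfun) simp
  also have "\<dots> = (norm a * norm (\<Sum>k<m. t (\<zeta> k) (e k)))\<^sup>2"
    by (simp add: power_mult_distrib norm_sum_orthonormal[OF e] sum_distrib_left)
  finally have "norm (\<Sum>k<m. t (a (\<zeta> k)) (e k)) \<le> norm a * norm (\<Sum>k<m. t (\<zeta> k) (e k))"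
    by (rule power2_le_imp_le) simp
  then show ?thesis unfolding rew a\<zeta> by (simp add: \<zeta>_def)
qed

text \<open>The operator is obtained as the closure of its graph on the algebraic tensor product,
  which avoids checking that it is well defined there.\<close>

lemma amplification_exists:
  fixes a :: "'a \<Rightarrow>\<^sub>L 'a"
  assumes a: "a \<in> bop"
  shows "\<exists>T\<in>bop. \<forall>\<xi> \<eta>. blinfun_apply T (t \<xi> \<eta>) = t (a \<xi>) \<eta>"
proof -
  define G0 where "G0 = {p. \<exists>(n::nat) \<xi> \<eta>. p = (\<Sum>i<n. t (\<xi> i) (\<eta> i), \<Sum>i<n. t (a (\<xi> i)) (\<eta> i))}"
  define G where "G = closure G0"
  have G0_add: "(u + u', v + v') \<in> G0" if "(u, v) \<in> G0" "(u', v') \<in> G0" for u u' v v'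
  proof -
    from that obtain n m :: nat and \<xi> \<eta> \<xi>' \<eta>' where
      *: "u = (\<Sum>i<n. t (\<xi> i) (\<eta> i))" "v = (\<Sum>i<n. t (a (\<xi> i)) (\<eta> i))"
      "u' = (\<Sum>i<m. t (\<xi>' i) (\<eta>' i))" "v' = (\<Sum>i<m. t (a (\<xi>' i)) (\<eta>' i))"
      unfolding G0_def by blast
    define \<alpha> where "\<alpha> i = (if i < n then \<xi> i else \<xi>' (i - n))" for i
    define \<beta> where "\<beta> i = (if i < n then \<eta> i else \<eta>' (i - n))" for i
    have app: "(\<Sum>i<n + m. t (g (\<alpha> i)) (\<beta> i)) = (\<Sum>i<n. t (g (\<xi> i)) (\<eta> i)) + (\<Sum>i<m. t (g (\<xi>' i)) (\<eta>' i))" for g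
      by (induction m) (simp_all add: \<alpha>_def \<beta>_def add.assoc)
    have "(u + u', v + v') = (\<Sum>i<n + m. t (\<alpha> i) (\<beta> i), \<Sum>i<n + m. t (a (\<alpha> i)) (\<beta> i))"
      using app[of "\<lambda>x. x"] app[of a] by (simp add: *)
    then show ?thesis unfolding G0_def by blast
  qed
  have G0_scale: "(c *\<^sub>C u, c *\<^sub>C v) \<in> G0" if "(u, v) \<in> G0" for c u v
  proof -
    from that obtain n :: nat and \<xi> \<eta> where
      *: "u = (\<Sum>i<n. t (\<xi> i) (\<eta> i))" "v = (\<Sum>i<n. t (a (\<xi> i)) (\<eta> i))"
      unfolding G0_def by blast
    have "(c *\<^sub>C u, c *\<^sub>C v) = (\<Sum>i<n. t (c *\<^sub>C \<xi> i) (\<eta> i), \<Sum>i<n. t (a (c *\<^sub>C \<xi> i)) (\<eta> i))"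
      by (simp add: * hs.scale_sum_right scale_left bop_scaleC[OF a])
    then show ?thesis unfolding G0_def mem_Collect_eq
      by (intro exI[of _ n] exI[of _ "\<lambda>i. c *\<^sub>C \<xi> i"] exI[of _ \<eta>])
  qed
  have seq: "p \<in> G \<longleftrightarrow> (\<exists>X. (\<forall>n::nat. X n \<in> G0) \<and> X \<longlonglongrightarrow> p)" for p
    unfolding G_def by (rule closure_sequential)
  have G_add: "(u + u', v + v') \<in> G" if "(u, v) \<in> G" "(u', v') \<in> G" for u u' v v'
  proof -
    from that obtain X Y where "\<And>n. X n \<in> G0" "X \<longlonglongrightarrow> (u, v)" "\<And>n. Y n \<in> G0" "Y \<longlonglongrightarrow> (u', v')"
      unfolding seq by blast
    then have "\<And>n. X n + Y n \<in> G0" "(\<lambda>n. X n + Y n) \<longlonglongrightarrow> (u, v) + (u', v')"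
      by (simp add: plus_prod_def G0_add) (rule tendsto_add; fact)
    then show ?thesis unfolding seq by (intro exI[of _ "\<lambda>n. X n + Y n"]) simp
  qed
  have G_scale: "(c *\<^sub>C u, c *\<^sub>C v) \<in> G" if "(u, v) \<in> G" for c u v
  proof -
    from that obtain X where "\<And>n. X n \<in> G0" "X \<longlonglongrightarrow> (u, v)" unfolding seq by blast
    then have "\<forall>n. (c *\<^sub>C fst (X n), c *\<^sub>C snd (X n)) \<in> G0"
      "(\<lambda>n. (c *\<^sub>C fst (X n), c *\<^sub>C snd (X n))) \<longlonglongrightarrow> (c *\<^sub>C u, c *\<^sub>C v)"
      by (auto intro!: G0_scale tendsto_Pair bounded_linear.tendsto[OF bounded_linear_scaleC]
          dest: tendsto_fst tendsto_snd)
    then show ?thesis unfolding seq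
      by (intro exI[of _ "\<lambda>n. (c *\<^sub>C fst (X n), c *\<^sub>C snd (X n))"] conjI)
  qed
  have G0_norm: "norm v \<le> norm a * norm u" if "(u, v) \<in> G0" for u v
    using that norm_amplification_le[OF a] unfolding G0_def by blast
  have G_norm: "norm v \<le> norm a * norm u" if "(u, v) \<in> G" for u v
  proof -
    have "closed {p :: 'c \<times> 'c. norm (snd p) \<le> norm a * norm (fst p)}"
      by (intro closed_Collect_le continuous_intros)
    moreover have "G0 \<subseteq> {p. norm (snd p) \<le> norm a * norm (fst p)}" using G0_norm by auto
    ultimately have "G \<subseteq> {p. norm (snd p) \<le> norm a * norm (fst p)}"
      unfolding G_def by (rule closure_minimal[rotated])
    then show ?thesis using that by auto
  qed
  \<comment> \<open>The difference of the two pairs is \<open>(0, v - v')\<close>, and the norm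
    bound kills its second entry.\<close>
  have G_unique: "v = v'" if "(u, v) \<in> G" "(u, v') \<in> G" for u v v'
  proof -
    have "(u + (-1) *\<^sub>C u, v + (-1) *\<^sub>C v') \<in> G" by (intro G_add G_scale that)
    then have "(0, v - v') \<in> G" by simp
    from G_norm[OF this] show ?thesis by simp
  qed
  \<comment> \<open>The norm bound turns a sequence of tensor sums converging to \<open>u\<close>
    into a Cauchy sequence of images, so the closed graph has a point over every
    \<open>u\<close>.\<close>
  have G_total: "\<exists>v. (u, v) \<in> G" for u
  proof -
    have "u \<in> closure (cspan {t \<xi> \<eta> | \<xi> \<eta>. True})" unfolding dense by simp
    then obtain X where X: "\<And>n::nat. X n \<in> cspan {t \<xi> \<eta> | \<xi> \<eta>. True}" "X \<longlonglongrightarrow> u"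
      unfolding closure_sequential by blast
    have "\<exists>v. (X n, v) \<in> G0" for n
    proof -
      obtain k :: nat and \<xi> \<eta> where "X n = (\<Sum>i<k. t (\<xi> i) (\<eta> i))"
        using span_tensors_repr[OF X(1)] .
      then show ?thesis unfolding G0_def by blast
    qed
    then obtain Y where Y: "\<And>n. (X n, Y n) \<in> G0" by metis
    have "Cauchy Y"
    proof (rule metric_CauchyI)
      fix e :: real assume e: "0 < e"
      \<comment> \<open>Adding 1 avoids a division by zero when \<open>a = 0\<close>.\<close>
      have "0 < e / (norm a + 1)" using e by (simp add: add_nonneg_pos)
      then obtain N where N: "\<forall>m\<ge>N. \<forall>n\<ge>N. dist (X m) (X n) < e / (norm a + 1)"
        using metric_CauchyD[OF LIMSEQ_imp_Cauchy[OF X(2)]] by blast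
      show "\<exists>M. \<forall>m\<ge>M. \<forall>n\<ge>M. dist (Y m) (Y n) < e"
      proof (intro exI allI impI)
        fix m n assume mn: "N \<le> m" "N \<le> n"
        have "(X m + (-1) *\<^sub>C X n, Y m + (-1) *\<^sub>C Y n) \<in> G0" by (intro G0_add G0_scale Y)
        from G0_norm[OF this] have "dist (Y m) (Y n) \<le> norm a * dist (X m) (X n)"
          by (simp add: dist_norm)
        also have "\<dots> \<le> (norm a + 1) * dist (X m) (X n)" by (simp add: mult_right_mono)
        also have "\<dots> < e" using N mn by (simp add: pos_less_divide_eq add_nonneg_pos mult.commute)
        finally show "dist (Y m) (Y n) < e" .
      qed
    qed
    then obtain v where "Y \<longlonglongrightarrow> v" by (auto simp: Cauchy_convergent_iff convergent_def)
    then have "(\<lambda>n. (X n, Y n)) \<longlonglongrightarrow> (u, v)" using X(2) by (intro tendsto_Pair)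
    then show ?thesis unfolding seq using Y by (intro exI[of _ v] exI[of _ "\<lambda>n. (X n, Y n)"] conjI allI)
  qed
  then obtain T where T: "\<And>u. (u, T u) \<in> G" by metis
  have T_eq: "T u = v" if "(u, v) \<in> G" for u v using G_unique[OF T that] .
  have sc: "T (c *\<^sub>C u) = c *\<^sub>C T u" for c u by (rule T_eq) (rule G_scale[OF T])
  have bl: "bounded_linear T"
  proof (rule bounded_linear_intro)
    show "T (u + v) = T u + T v" for u v by (rule T_eq) (rule G_add[OF T T])
    show "T (r *\<^sub>R u) = r *\<^sub>R T u" for r u by (simp add: scaleR_scaleC sc)
    show "norm (T u) \<le> norm u * norm a" for u using G_norm[OF T] by (simp add: mult.commute)
  qed
  have "T (t \<xi> \<eta>) = t (a \<xi>) \<eta>" for \<xi> \<eta>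
  proof (rule T_eq)
    have "(t \<xi> \<eta>, t (a \<xi>) \<eta>) \<in> G0" unfolding G0_def mem_Collect_eq
      by (intro exI[of _ 1] exI[of _ "\<lambda>_. \<xi>"] exI[of _ "\<lambda>_. \<eta>"]) simp
    then show "(t \<xi> \<eta>, t (a \<xi>) \<eta>) \<in> G" unfolding G_def using closure_subset by blast
  qed
  then show ?thesis
    by (intro bexI[of _ "Blinfun T"])
      (simp_all add: bop_def bounded_linear_Blinfun_apply[OF bl] sc)
qed

text \<open>The operator is the product of \<open>a \<otimes> 1\<close> and
  \<open>1 \<otimes> b\<close>, the second factor coming from the flipped tensor product.\<close>

lemma op_tensor_exists:
  fixes a :: "'a \<Rightarrow>\<^sub>L 'a" and b :: "'b \<Rightarrow>\<^sub>L 'b"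
  assumes "a \<in> bop" "b \<in> bop"
  shows "\<exists>T\<in>bop. \<forall>\<xi> \<eta>. blinfun_apply T (t \<xi> \<eta>) = t (a \<xi>) (b \<eta>)"
proof -
  interpret flip: htensor "\<lambda>\<eta> \<xi>. t \<xi> \<eta>" by unfold_locales (rule hilbert_tensor_flip)
  from amplification_exists[OF assms(1)] obtain S :: "'c \<Rightarrow>\<^sub>L 'c"
    where S: "S \<in> bop" "\<And>\<xi> \<eta>. S (t \<xi> \<eta>) = t (a \<xi>) \<eta>" by blast
  from flip.amplification_exists[OF assms(2)] obtain T :: "'c \<Rightarrow>\<^sub>L 'c"
    where T: "T \<in> bop" "\<And>\<xi> \<eta>. T (t \<xi> \<eta>) = t \<xi> (b \<eta>)" by blast
  show ?thesis by (rule bexI[of _ "S o\<^sub>L T"]) (simp_all add: S T comp_bop)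
qed

lemma op_tensor_unique:
  fixes a :: "'a \<Rightarrow>\<^sub>L 'a" and b :: "'b \<Rightarrow>\<^sub>L 'b"
  assumes "T \<in> bop" "\<And>\<xi> \<eta>. T (t \<xi> \<eta>) = t (a \<xi>) (b \<eta>)"
  shows "op_tensor t a b = T"
  unfolding op_tensor_def
proof (rule the_equality)
  fix T' :: "'c \<Rightarrow>\<^sub>L 'c" assume "T' \<in> bop \<and> (\<forall>\<xi> \<eta>. T' (t \<xi> \<eta>) = t (a \<xi>) (b \<eta>))"
  then show "T' = T" by (intro tensor_op_eqI) (simp_all add: assms)
qed (use assms in blast)

lemma
  fixes a :: "'a \<Rightarrow>\<^sub>L 'a" and b :: "'b \<Rightarrow>\<^sub>L 'b"
  assumes "a \<in> bop" "b \<in> bop"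
  shows op_tensor_bop [simp, intro]: "op_tensor t a b \<in> bop"
    and op_tensor_apply: "op_tensor t a b (t \<xi> \<eta>) = t (a \<xi>) (b \<eta>)"
proof -
  from op_tensor_exists[OF assms] obtain T :: "'c \<Rightarrow>\<^sub>L 'c"
    where T: "T \<in> bop" "\<And>\<xi> \<eta>. T (t \<xi> \<eta>) = t (a \<xi>) (b \<eta>)" by blast
  with op_tensor_unique[of T a b] have "op_tensor t a b = T" by blast
  with T show "op_tensor t a b \<in> bop" "op_tensor t a b (t \<xi> \<eta>) = t (a \<xi>) (b \<eta>)" by simp_all
qed

lemma op_tensor_comp:
  assumes "a \<in> bop" "b \<in> bop" "a' \<in> bop" "b' \<in> bop"
  shows "op_tensor t a b o\<^sub>L op_tensor t a' b' = op_tensor t (a o\<^sub>L a') (b o\<^sub>L b')"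
  by (rule op_tensor_unique[symmetric]) (simp_all add: assms comp_bop op_tensor_apply)

lemma op_tensor_add_left:
  assumes "a \<in> bop" "a' \<in> bop" "b \<in> bop"
  shows "op_tensor t (a + a') b = op_tensor t a b + op_tensor t a' b"
  by (rule op_tensor_unique) (simp_all add: assms add_bop op_tensor_apply blinfun.add_left add_left)

lemma op_tensor_add_right:
  assumes "a \<in> bop" "b \<in> bop" "b' \<in> bop"
  shows "op_tensor t a (b + b') = op_tensor t a b + op_tensor t a b'"
  by (rule op_tensor_unique) (simp_all add: assms add_bop op_tensor_apply blinfun.add_left add_right)

lemma op_tensor_scale_left:
  assumes "a \<in> bop" "b \<in> bop"
  shows "op_tensor t (scale_op c a) b = scale_op c (op_tensor t a b)"
  by (rule op_tensor_unique) (simp_all add: assms scale_bop op_tensor_apply scale_left)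

lemma op_tensor_scale_right:
  assumes "a \<in> bop" "b \<in> bop"
  shows "op_tensor t a (scale_op c b) = scale_op c (op_tensor t a b)"
  by (rule op_tensor_unique) (simp_all add: assms scale_bop op_tensor_apply scale_right)

lemma op_tensor_zero_left [simp]: "b \<in> bop \<Longrightarrow> op_tensor t 0 b = 0"
  by (rule op_tensor_unique) simp_all

lemma op_tensor_zero_right [simp]: "a \<in> bop \<Longrightarrow> op_tensor t a 0 = 0"
  by (rule op_tensor_unique) simp_all

lemma op_tensor_id [simp]: "op_tensor t id_blinfun id_blinfun = id_blinfun"
  by (rule op_tensor_unique) simp_all

lemma op_tensor_sum_left:
  "(\<And>i. i \<in> I \<Longrightarrow> f i \<in> bop) \<Longrightarrow> b \<in> bop \<Longrightarrow> op_tensor t (sum f I) b = (\<Sum>i\<in>I. op_tensor t (f i) b)"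
  by (induction I rule: infinite_finite_induct) (simp_all add: op_tensor_add_left sum_bop)

lemma op_tensor_sum_right:
  "(\<And>i. i \<in> I \<Longrightarrow> f i \<in> bop) \<Longrightarrow> a \<in> bop \<Longrightarrow> op_tensor t a (sum f I) = (\<Sum>i\<in>I. op_tensor t a (f i))"
  by (induction I rule: infinite_finite_induct) (simp_all add: op_tensor_add_right sum_bop)

lemma adj_op_tensor:
  assumes "a \<in> bop" "b \<in> bop"
  shows "adj (op_tensor t a b) = op_tensor t (adj a) (adj b)"
  by (rule tensor_op_eqI)
    (simp_all add: assms op_tensor_apply cinner_adj_left cinner_t)

end


section \<open>Commutants and slices\<close>

lemma commutant_bop: "T \<in> commutant S \<Longrightarrow> T \<in> bop"
  by (simp add: commutant_def)

lemma commutant_comm: "T \<in> commutant S \<Longrightarrow> s \<in> S \<Longrightarrow> T o\<^sub>L s = s o\<^sub>L T"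
  by (simp add: commutant_def)

lemma commutant_antimono: "S \<subseteq> T \<Longrightarrow> commutant T \<subseteq> commutant S"
  by (auto simp: commutant_def)

lemma id_commutant: "id_blinfun \<in> commutant S"
  by (auto simp: commutant_def intro: blinfun_eqI)

lemma zero_commutant: "S \<subseteq> bop \<Longrightarrow> 0 \<in> commutant S"
  by (auto simp: commutant_def intro!: blinfun_eqI)

lemma add_commutant: "T \<in> commutant S \<Longrightarrow> T' \<in> commutant S \<Longrightarrow> T + T' \<in> commutant S"
  by (auto simp: commutant_def add_bop comp_add_left comp_add_right)

lemma comp_commutant: "T \<in> commutant S \<Longrightarrow> T' \<in> commutant S \<Longrightarrow> T o\<^sub>L T' \<in> commutant S"
  unfolding commutant_def by (auto simp: comp_bop comp_assoc) (metis comp_assoc)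

lemma scale_commutant: "S \<subseteq> bop \<Longrightarrow> T \<in> commutant S \<Longrightarrow> scale_op c T \<in> commutant S"
  by (auto simp: commutant_def scale_bop scale_op_comp_left scale_op_comp_right subset_iff)

lemma adj_commutant:
  assumes "S \<subseteq> bop" "\<And>s. s \<in> S \<Longrightarrow> adj s \<in> S" "T \<in> commutant S"
  shows "adj T \<in> commutant S"
proof -
  have T: "T \<in> bop" using assms(3) by (rule commutant_bop)
  have "adj T o\<^sub>L s = s o\<^sub>L adj T" if "s \<in> S" for s
  proof -
    have s: "s \<in> bop" "adj s \<in> bop" using that assms by auto
    have "adj (adj s o\<^sub>L T) = adj (T o\<^sub>L adj s)"
      using commutant_comm[OF assms(3) assms(2)[OF that]] by simp
    then show ?thesis using s T by (simp add: adj_comp)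
  qed
  then show ?thesis using T by (simp add: commutant_def)
qed

lemma subset_bicommutant: "S \<subseteq> bop \<Longrightarrow> S \<subseteq> commutant (commutant S)"
  unfolding commutant_def by auto

lemma norm_le_of_form:
  fixes S :: "'a::chilbert_space \<Rightarrow>\<^sub>L 'a"
  assumes "0 \<le> K" "\<And>x y. cmod (cinner (S x) y) \<le> K * norm x * norm y"
  shows "norm S \<le> K"
proof (rule norm_blinfun_bound[OF assms(1)])
  fix x
  show "norm (S x) \<le> K * norm x"
  proof (cases "S x = 0")
    case False
    have "(norm (S x))\<^sup>2 = cmod (cinner (S x) (S x))" by (simp add: cinner_self norm_power)
    also have "\<dots> \<le> K * norm x * norm (S x)" by (rule assms(2))
    finally show ?thesis using False by (simp add: power2_eq_square)
  qed (use assms(1) in simp)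
qed

section \<open>Slice maps and the location of their values\<close>

context htensor
begin

text \<open>The slice \<open>(id \<otimes> \<omega>)(X)\<close> for the vector functional \<open>\<omega> = \<langle>\<cdot> \<eta>, \<eta>'\<rangle>\<close>.\<close>

definition slice :: "'b \<Rightarrow> 'b \<Rightarrow> ('c \<Rightarrow>\<^sub>L 'c) \<Rightarrow> ('a \<Rightarrow>\<^sub>L 'a)" where
  "slice \<eta> \<eta>' X = (SOME S. S \<in> bop \<and> (\<forall>\<alpha> \<beta>. cinner (S \<alpha>) \<beta> = cinner (X (t \<alpha> \<eta>)) (t \<beta> \<eta>')))"

lemma
  assumes X: "X \<in> bop"
  shows slice_bop [simp, intro]: "slice \<eta> \<eta>' X \<in> bop"
    and cinner_slice: "cinner (slice \<eta> \<eta>' X \<alpha>) \<beta> = cinner (X (t \<alpha> \<eta>)) (t \<beta> \<eta>')"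
proof -
  have "\<exists>S\<in>bop. \<forall>\<alpha> \<beta>. cinner (blinfun_apply S \<alpha>) \<beta> = cinner (X (t \<alpha> \<eta>)) (t \<beta> \<eta>')"
  proof (rule bop_of_form)
    fix x y
    have "cmod (cinner (X (t x \<eta>)) (t y \<eta>')) \<le> norm (X (t x \<eta>)) * norm (t y \<eta>')"
      by (rule cinner_Cauchy_Schwarz)
    also have "\<dots> \<le> (norm X * norm (t x \<eta>)) * norm (t y \<eta>')"
      by (intro mult_right_mono norm_blinfun) simp
    finally show "cmod (cinner (X (t x \<eta>)) (t y \<eta>')) \<le> (norm X * norm \<eta> * norm \<eta>') * norm x * norm y"
      by (simp add: norm_t mult_ac)
  qed (simp_all add: add_left scale_left cinner_simps blinfun.add_right bop_scaleC[OF X])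
  then have "\<exists>S. S \<in> bop \<and> (\<forall>\<alpha> \<beta>. cinner (blinfun_apply S \<alpha>) \<beta> = cinner (X (t \<alpha> \<eta>)) (t \<beta> \<eta>'))"
    by blast
  from someI_ex[OF this] show "slice \<eta> \<eta>' X \<in> bop"
    "cinner (slice \<eta> \<eta>' X \<alpha>) \<beta> = cinner (X (t \<alpha> \<eta>)) (t \<beta> \<eta>')"
    unfolding slice_def by blast+
qed

lemma norm_slice_diff_le:
  assumes "X \<in> bop" "Y \<in> bop"
  shows "norm (slice \<eta> \<eta>' X - slice \<eta> \<eta>' Y) \<le> norm (X - Y) * (norm \<eta> * norm \<eta>')"
proof (rule norm_le_of_form)
  fix x y
  have "cmod (cinner ((slice \<eta> \<eta>' X - slice \<eta> \<eta>' Y) x) y) = cmod (cinner ((X - Y) (t x \<eta>)) (t y \<eta>'))"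
    by (simp add: blinfun.diff_left cinner_simps cinner_slice assms)
  also have "\<dots> \<le> norm ((X - Y) (t x \<eta>)) * norm (t y \<eta>')"
    by (rule cinner_Cauchy_Schwarz)
  also have "\<dots> \<le> (norm (X - Y) * norm (t x \<eta>)) * norm (t y \<eta>')"
    by (intro mult_right_mono norm_blinfun) simp
  finally show "cmod (cinner ((slice \<eta> \<eta>' X - slice \<eta> \<eta>' Y) x) y)
      \<le> norm (X - Y) * (norm \<eta> * norm \<eta>') * norm x * norm y"
    by (simp add: norm_t mult_ac)
qed simp

lemma alg_tensor_bop:
  assumes "M \<subseteq> bop" "N \<subseteq> bop"
  shows "alg_tensor t M N \<subseteq> bop"
  unfolding alg_tensor_def
  by (rule ops.span_minimal) (use assms in \<open>auto simp: ops.subspace_def add_bop scale_bop\<close>)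

text \<open>If \<open>T\<close> commutes with \<open>M\<close>, then \<open>T \<otimes> 1\<close>
  commutes with the algebraic tensor product, hence with \<open>X\<close>; slicing carries this over
  to \<open>T\<close> and the slice.\<close>

lemma slice_vn_tensor:
  assumes M: "M \<subseteq> bop" and N: "N \<subseteq> bop" and X: "X \<in> vn_tensor t M N"
  shows "slice \<eta> \<eta>' X \<in> commutant (commutant M)"
proof -
  have Xb: "X \<in> bop" using X commutant_bop unfolding vn_tensor_def by blast
  have "slice \<eta> \<eta>' X o\<^sub>L T = T o\<^sub>L slice \<eta> \<eta>' X" if T: "T \<in> commutant M" for T
  proof -
    have Tb: "T \<in> bop" by (rule commutant_bop[OF T])
    let ?T = "op_tensor t T id_blinfun"
    have "alg_tensor t M N \<subseteq> {Y \<in> bop. ?T o\<^sub>L Y = Y o\<^sub>L ?T}"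
      unfolding alg_tensor_def
    proof (rule ops.span_minimal)
      show "{op_tensor t a b |a b. a \<in> M \<and> b \<in> N} \<subseteq> {Y \<in> bop. ?T o\<^sub>L Y = Y o\<^sub>L ?T}"
        using M N Tb by (auto simp: op_tensor_comp subset_iff commutant_comm[OF T])
      show "ops.subspace {Y \<in> bop. ?T o\<^sub>L Y = Y o\<^sub>L ?T}"
        using Tb by (auto simp: ops.subspace_def add_bop scale_bop comp_add_left
            comp_add_right scale_op_comp_left scale_op_comp_right)
    qed
    then have "?T \<in> commutant (alg_tensor t M N)"
      using Tb by (auto simp: commutant_def)
    then have comm: "X o\<^sub>L ?T = ?T o\<^sub>L X"
      using X unfolding vn_tensor_def by (intro commutant_comm)
    show ?thesis
    proof (rule op_eqI)
      fix \<alpha> \<beta>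
      have "cinner ((slice \<eta> \<eta>' X o\<^sub>L T) \<alpha>) \<beta> = cinner ((X o\<^sub>L ?T) (t \<alpha> \<eta>)) (t \<beta> \<eta>')"
        by (simp add: cinner_slice Xb op_tensor_apply Tb)
      also have "\<dots> = cinner (X (t \<alpha> \<eta>)) (adj ?T (t \<beta> \<eta>'))"
        unfolding comm by (simp add: cinner_adj_right Tb)
      also have "\<dots> = cinner (slice \<eta> \<eta>' X \<alpha>) (adj T \<beta>)"
        by (simp add: adj_op_tensor op_tensor_apply Tb cinner_slice Xb)
      also have "\<dots> = cinner ((T o\<^sub>L slice \<eta> \<eta>' X) \<alpha>) \<beta>"
        by (simp add: cinner_adj_right Tb)
      finally show "cinner ((slice \<eta> \<eta>' X o\<^sub>L T) \<alpha>) \<beta> = cinner ((T o\<^sub>L slice \<eta> \<eta>' X) \<alpha>) \<beta>" .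
    qed
  qed
  then show ?thesis by (auto simp: commutant_def[of "commutant M"] Xb)
qed

text \<open>A slice of an elementary tensor is a scalar multiple of its first leg, and slicing is
  linear.\<close>

lemma slice_alg_tensor:
  assumes M: "M \<subseteq> bop" "ops.subspace M" and N: "N \<subseteq> bop" and X: "X \<in> alg_tensor t M N"
  shows "slice \<eta> \<eta>' X \<in> M"
proof -
  have "alg_tensor t M N \<subseteq> {Y \<in> bop. slice \<eta> \<eta>' Y \<in> M}"
    unfolding alg_tensor_def
  proof (rule ops.span_minimal)
    have "slice \<eta> \<eta>' (op_tensor t a b) \<in> M" if "a \<in> M" "b \<in> N" for a b
    proof -
      have ab: "a \<in> bop" "b \<in> bop" using that M N by auto
      have "slice \<eta> \<eta>' (op_tensor t a b) = scale_op (cinner (b \<eta>) \<eta>') a"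
        by (rule op_eqI) (simp add: cinner_slice ab op_tensor_apply cinner_t cinner_simps mult.commute)
      then show ?thesis using that M by (simp add: ops.subspace_scale)
    qed
    then show "{op_tensor t a b |a b. a \<in> M \<and> b \<in> N} \<subseteq> {Y \<in> bop. slice \<eta> \<eta>' Y \<in> M}"
      using M N by (auto simp: subset_iff)
    have 0: "slice \<eta> \<eta>' 0 = 0"
      by (rule op_eqI) (simp add: cinner_slice)
    have add: "slice \<eta> \<eta>' (X + Y) = slice \<eta> \<eta>' X + slice \<eta> \<eta>' Y" if "X \<in> bop" "Y \<in> bop" for X Y
      by (rule op_eqI) (simp add: cinner_slice that add_bop blinfun.add_left cinner_simps)
    have scale: "slice \<eta> \<eta>' (scale_op c X) = scale_op c (slice \<eta> \<eta>' X)" if "X \<in> bop" for X c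
      by (rule op_eqI) (simp add: cinner_slice that scale_bop cinner_simps)
    show "ops.subspace {Y \<in> bop. slice \<eta> \<eta>' Y \<in> M}"
      using M(2) by (auto simp: ops.subspace_def add_bop scale_bop 0 add scale)
  qed
  then show ?thesis using X by blast
qed

text \<open>Slicing is norm continuous, so the algebraic case passes to the closure because
  \<open>M\<close> is closed.\<close>

lemma slice_min_tensor:
  assumes M: "M \<subseteq> bop" "ops.subspace M" "closed M" and N: "N \<subseteq> bop"
    and X: "X \<in> min_tensor t M N" "X \<in> bop"
  shows "slice \<eta> \<eta>' X \<in> M"
proof -
  from X obtain Y where Y: "\<And>n::nat. Y n \<in> alg_tensor t M N" "Y \<longlonglongrightarrow> X"
    unfolding min_tensor_def closure_sequential by blast
  have "(\<lambda>n. slice \<eta> \<eta>' (Y n)) \<longlonglongrightarrow> slice \<eta> \<eta>' X"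
  proof (rule LIM_zero_cancel, rule tendsto_norm_zero_cancel, rule tendsto_sandwich[OF _ _ tendsto_const])
    show "\<forall>\<^sub>F n in sequentially. norm (slice \<eta> \<eta>' (Y n) - slice \<eta> \<eta>' X) \<le> norm (Y n - X) * (norm \<eta> * norm \<eta>')"
      using Y(1) alg_tensor_bop[OF M(1) N] X(2) by (intro always_eventually allI norm_slice_diff_le) auto
    have "(\<lambda>n. norm (Y n - X)) \<longlonglongrightarrow> 0" using Y(2) by (intro tendsto_norm_zero LIM_zero)
    then show "(\<lambda>n. norm (Y n - X) * (norm \<eta> * norm \<eta>')) \<longlonglongrightarrow> 0"
      by (rule tendsto_mult_left_zero)
  qed simp
  then show ?thesis
    by (rule closed_sequentially[OF M(3), rotated])
      (use slice_alg_tensor[OF M(1,2) N Y(1)] in blast)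
qed

end

section \<open>Inverses of scalar matrices, Gram matrices and dual vectors\<close>

lemma matrix_inverse_exists:
  fixes G :: "nat \<Rightarrow> nat \<Rightarrow> complex"
  assumes "\<And>v i. (\<And>i. i < n \<Longrightarrow> (\<Sum>j<n. G i j * v j) = 0) \<Longrightarrow> i < n \<Longrightarrow> v i = 0"
  shows "\<exists>H. \<forall>i<n. \<forall>j<n. (\<Sum>k<n. G i k * H k j) = (if i = j then 1 else 0) \<and>
    (\<Sum>k<n. H i k * G k j) = (if i = j then 1 else 0)"
proof -
  define A where "A = mat n n (\<lambda>(i, j). G i j)"
  have A: "A \<in> carrier_mat n n" by (simp add: A_def)
  have "det A \<noteq> 0"
  proof
    assume "det A = 0"
    then obtain v where v: "v \<in> carrier_vec n" "v \<noteq> 0\<^sub>v n" "A *\<^sub>v v = 0\<^sub>v n"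
      using det_0_iff_vec_prod_zero_field[OF A] by blast
    have "(\<Sum>j<n. G i j * vec_index v j) = 0" if "i < n" for i
    proof -
      have "vec_index (A *\<^sub>v v) i = (\<Sum>j<n. G i j * vec_index v j)"
        using that v(1) by (simp add: A_def scalar_prod_def lessThan_atLeast0)
      then show ?thesis using v(3) that by simp
    qed
    then have "\<And>i. i < n \<Longrightarrow> vec_index v i = 0" by (rule assms)
    then have "v = 0\<^sub>v n" using v(1) by (intro eq_vecI) auto
    with v(2) show False by simp
  qed
  from det_non_zero_imp_unit[OF A this]
  obtain B where B: "B \<in> carrier_mat n n" "B * A = 1\<^sub>m n" "A * B = 1\<^sub>m n"
    by (auto simp: Units_def ring_mat_simps)
  have "(\<Sum>k<n. G i k * B $$ (k, j)) = (if i = j then 1 else 0) \<and>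
    (\<Sum>k<n. B $$ (i, k) * G k j) = (if i = j then 1 else 0)" if ij: "i < n" "j < n" for i j
  proof -
    have "(A * B) $$ (i, j) = (\<Sum>k<n. G i k * B $$ (k, j))"
      "(B * A) $$ (i, j) = (\<Sum>k<n. B $$ (i, k) * G k j)"
      using ij B(1) by (simp_all add: A_def scalar_prod_def lessThan_atLeast0)
    then show ?thesis using B ij by simp
  qed
  then show ?thesis by (intro exI[of _ "\<lambda>k j. B $$ (k, j)"]) blast
qed

text \<open>If \<open>v\<close> lies in the kernel of the summed Gram matrix \<open>G\<close>, then
  \<open>v\<^sup>* G v = 0\<close> is a sum of squared norms, so \<open>v\<close> kills every row of
  \<open>X\<close>. In the applications the vectors are mostly matrix entries applied to
  \<open>\<Omega>\<close>, and \<open>G\<close> is the Haar state of a product such as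
  \<open>c\<^sup>* c\<close>.\<close>

lemma gram_inverse_exists:
  fixes X :: "nat \<Rightarrow> nat \<Rightarrow> 'a::chilbert_space"
  assumes "\<And>v i. (\<And>k. k < m \<Longrightarrow> (\<Sum>i<n. v i *\<^sub>C X k i) = 0) \<Longrightarrow> i < n \<Longrightarrow> v i = 0"
  shows "\<exists>H. \<forall>i<n. \<forall>j<n.
    (\<Sum>k<n. (\<Sum>l<m. cinner (X l k) (X l i)) * H k j) = (if i = j then 1 else 0) \<and>
    (\<Sum>k<n. H i k * (\<Sum>l<m. cinner (X l j) (X l k))) = (if i = j then 1 else 0)"
proof (rule matrix_inverse_exists)
  fix v :: "nat \<Rightarrow> complex" and i
  assume v: "\<And>i. i < n \<Longrightarrow> (\<Sum>j<n. (\<Sum>l<m. cinner (X l j) (X l i)) * v j) = 0" and i: "i < n"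
  define s where "s l = (\<Sum>j<n. v j *\<^sub>C X l j)" for l
  have "(\<Sum>l<m. cinner (s l) (s l)) = (\<Sum>l<m. \<Sum>i<n. \<Sum>j<n. cnj (v i) * (v j * cinner (X l j) (X l i)))"
    by (simp add: s_def cinner_simps sum_distrib_left)
  also have "\<dots> = (\<Sum>i<n. \<Sum>l<m. \<Sum>j<n. cnj (v i) * (v j * cinner (X l j) (X l i)))"
    by (rule sum.swap)
  also have "\<dots> = (\<Sum>i<n. cnj (v i) * (\<Sum>j<n. (\<Sum>l<m. cinner (X l j) (X l i)) * v j))"
  proof (intro sum.cong refl)
    fix i
    have "(\<Sum>l<m. \<Sum>j<n. cnj (v i) * (v j * cinner (X l j) (X l i)))
        = (\<Sum>j<n. \<Sum>l<m. cnj (v i) * (v j * cinner (X l j) (X l i)))" by (rule sum.swap)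
    also have "\<dots> = cnj (v i) * (\<Sum>j<n. (\<Sum>l<m. cinner (X l j) (X l i)) * v j)"
      by (simp add: sum_distrib_left sum_distrib_right mult_ac)
    finally show "(\<Sum>l<m. \<Sum>j<n. cnj (v i) * (v j * cinner (X l j) (X l i)))
        = cnj (v i) * (\<Sum>j<n. (\<Sum>l<m. cinner (X l j) (X l i)) * v j)" .
  qed
  also have "\<dots> = 0" by (simp add: v)
  finally have "complex_of_real (\<Sum>l<m. (norm (s l))\<^sup>2) = 0"
    by (simp only: cinner_self of_real_sum)
  then have "(\<Sum>l<m. (norm (s l))\<^sup>2) = 0" by (simp only: of_real_eq_0_iff)
  then have "s l = 0" if "l < m" for l
    using that by (simp add: sum_nonneg_eq_0_iff)
  then show "v i = 0" using assms[of v i] i by (simp add: s_def)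
qed

text \<open>The dual family is the inverse Gram matrix applied to the vectors, with conjugated
  entries because the inner product is conjugate-linear in its second variable.\<close>

lemma dual_vectors_exist:
  fixes x :: "nat \<Rightarrow> 'a::chilbert_space"
  assumes "\<And>v i. (\<Sum>i<n. v i *\<^sub>C x i) = 0 \<Longrightarrow> i < n \<Longrightarrow> v i = 0"
  shows "\<exists>y. \<forall>i<n. \<forall>j<n. cinner (x i) (y j) = (if i = j then 1 else 0)"
proof -
  from gram_inverse_exists[where X = "\<lambda>_. x" and m = 1 and n = n] assms
  obtain H where H: "\<And>i j. i < n \<Longrightarrow> j < n \<Longrightarrow>
      (\<Sum>k<n. H i k * cinner (x j) (x k)) = (if i = j then 1 else 0)"
    by (simp add: lessThan_Suc) metis
  show ?thesis
    by (intro exI[of _ "\<lambda>j. \<Sum>k<n. cnj (H j k) *\<^sub>C x k"]) (auto simp: cinner_simps H)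
qed


section \<open>Minimal tensor decompositions and operator matrices\<close>

lemma bounded_linear_scale_op:
  "bounded_linear (\<lambda>c. scale_op c (T :: 'a::chilbert_space \<Rightarrow>\<^sub>L 'a))"
proof (rule bounded_linear_intro)
  fix c d :: complex and r :: real
  show "scale_op (c + d) T = scale_op c T + scale_op d T"
    by (rule ops.scale_left_distrib)
  show "scale_op (r *\<^sub>R c) T = r *\<^sub>R scale_op c T"
    by (rule blinfun_eqI) (simp add: scaleR_scaleC scaleC_scaleC scaleR_conv_of_real blinfun.scaleR_left)
  show "norm (scale_op c T) \<le> norm c * norm T"
  proof (rule norm_blinfun_bound)
    fix x
    have "norm (scale_op c T x) = norm c * norm (T x)" by (simp add: norm_scaleC)
    also have "\<dots> \<le> norm c * (norm T * norm x)" by (intro mult_left_mono norm_blinfun) simp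
    finally show "norm (scale_op c T x) \<le> norm c * norm T * norm x" by (simp add: mult.assoc)
  qed simp
qed

lemma commutant_subspace: "S \<subseteq> bop \<Longrightarrow> ops.subspace (commutant S)"
  by (simp add: ops.subspace_def zero_commutant add_commutant scale_commutant)

lemma star_hom_sum:
  assumes "normal_unital_star_hom (commutant S) N \<Phi>" "S \<subseteq> bop"
    and f: "\<And>i. i \<in> I \<Longrightarrow> f i \<in> commutant S"
  shows "\<Phi> (sum f I) = (\<Sum>i\<in>I. \<Phi> (f i))"
proof -
  have add: "\<Phi> (x + y) = \<Phi> x + \<Phi> y" if "x \<in> commutant S" "y \<in> commutant S" for x y
    using assms(1) that by (simp add: normal_unital_star_hom_def)
  have sub: "ops.subspace (commutant S)" by (rule commutant_subspace[OF assms(2)])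
  have 0: "\<Phi> 0 = 0"
    using add[of 0 0] zero_commutant[OF assms(2)] by simp
  show ?thesis
    using f
  proof (induction I rule: infinite_finite_induct)
    case (insert i I)
    then show ?case by (simp add: add ops.subspace_sum[OF sub])
  qed (simp_all add: 0)
qed

text \<open>The scalar coefficients of the span are absorbed into the first legs.\<close>

lemma alg_tensor_repr:
  assumes "\<And>c a. a \<in> M \<Longrightarrow> scale_op c a \<in> M" "M \<subseteq> bop" "N \<subseteq> bop" "hilbert_tensor t"
    and "X \<in> alg_tensor t M N"
  shows "\<exists>(n::nat) a b. (\<forall>i<n. a i \<in> M \<and> b i \<in> N) \<and> X = (\<Sum>i<n. op_tensor t (a i) (b i))"
  using assms(5) unfolding alg_tensor_def
proof (induction rule: ops.span_induct_alt)
  case base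
  show ?case by (rule exI[of _ 0]) simp
next
  case (step c x y)
  interpret htensor t by unfold_locales (rule assms(4))
  from step obtain n :: nat and a b p q where *: "\<forall>i<n. a i \<in> M \<and> b i \<in> N"
    "y = (\<Sum>i<n. op_tensor t (a i) (b i))" "x = op_tensor t p q" "p \<in> M" "q \<in> N" by blast
  have "p \<in> bop" "q \<in> bop" using * assms by auto
  then have "scale_op c x + y = (\<Sum>i<Suc n. op_tensor t ((a(n := scale_op c p)) i) ((b(n := q)) i))"
    by (simp add: * op_tensor_scale_left)
  moreover have "\<forall>i<Suc n. (a(n := scale_op c p)) i \<in> M \<and> (b(n := q)) i \<in> N"
    using * assms(1) by (simp add: less_Suc_eq)
  ultimately show ?case by blast
qed

section \<open>Linear independence and decompositions of least length\<close>

definition op_independent :: "nat \<Rightarrow> (nat \<Rightarrow> 'a::chilbert_space \<Rightarrow>\<^sub>L 'a) \<Rightarrow> bool" where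
  "op_independent n a \<longleftrightarrow> (\<forall>v. (\<Sum>i<n. scale_op (v i) (a i)) = 0 \<longrightarrow> (\<forall>i<n. v i = 0))"

text \<open>A dependence lets one \<open>a m\<close> be written through the others and its term be
  spread over theirs. The bilinear map is abstract so that the same argument serves either leg of a
  tensor.\<close>

lemma bilinear_sum_shorten:
  fixes f :: "('a::chilbert_space \<Rightarrow>\<^sub>L 'a) \<Rightarrow> ('a \<Rightarrow>\<^sub>L 'a) \<Rightarrow> ('c::chilbert_space \<Rightarrow>\<^sub>L 'c)"
  assumes sub: "ops.subspace M"
    and f_sum: "\<And>(I :: nat set) g b. (\<And>i. i \<in> I \<Longrightarrow> g i \<in> M) \<Longrightarrow> b \<in> M \<Longrightarrow> f (sum g I) b = (\<Sum>i\<in>I. f (g i) b)"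
    and f_add: "\<And>a b b'. a \<in> M \<Longrightarrow> b \<in> M \<Longrightarrow> b' \<in> M \<Longrightarrow> f a (b + b') = f a b + f a b'"
    and f_scale: "\<And>c a b. a \<in> M \<Longrightarrow> b \<in> M \<Longrightarrow> f (scale_op c a) b = f a (scale_op c b)"
    and ab: "\<forall>i<Suc n. a i \<in> M \<and> b i \<in> M" and dep: "\<not> op_independent (Suc n) a"
  shows "\<exists>a' b'. (\<forall>i<n. a' i \<in> M \<and> b' i \<in> M) \<and> (\<Sum>i<Suc n. f (a i) (b i)) = (\<Sum>i<n. f (a' i) (b' i))"
proof -
  from dep obtain v m where v: "(\<Sum>i<Suc n. scale_op (v i) (a i)) = 0" and m: "m < Suc n" "v m \<noteq> 0"
    unfolding op_independent_def by blast
  define I where "I = {..<Suc n} - {m}"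
  \<comment> \<open>Coefficients that express \<open>a m\<close> through the remaining
    \<open>a i\<close>.\<close>
  define u where "u i = - v i / v m" for i
  have I: "finite I" "m \<notin> I" "{..<Suc n} = insert m I" "card I = n"
    using m(1) by (auto simp: I_def)
  have "(\<Sum>i\<in>I. scale_op (u i) (a i)) = scale_op (- 1 / v m) (\<Sum>i\<in>I. scale_op (v i) (a i))"
    by (simp add: ops.scale_sum_right u_def)
  also have "(\<Sum>i\<in>I. scale_op (v i) (a i)) = scale_op (- v m) (a m)"
    using v I by (simp add: eq_neg_iff_add_eq_0 add.commute)
  finally have am: "(\<Sum>i\<in>I. scale_op (u i) (a i)) = a m" using m(2) by simp
  have abI: "a i \<in> M" "b i \<in> M" if "i \<in> I" for i using that ab by (auto simp: I_def)
  have abm: "a m \<in> M" "b m \<in> M" using m ab by auto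
  have "(\<Sum>i<Suc n. f (a i) (b i)) = f (\<Sum>i\<in>I. scale_op (u i) (a i)) (b m) + (\<Sum>i\<in>I. f (a i) (b i))"
    using I am by simp
  also have "f (\<Sum>i\<in>I. scale_op (u i) (a i)) (b m) = (\<Sum>i\<in>I. f (a i) (scale_op (u i) (b m)))"
  proof -
    have "f (\<Sum>i\<in>I. scale_op (u i) (a i)) (b m) = (\<Sum>i\<in>I. f (scale_op (u i) (a i)) (b m))"
      by (intro f_sum ops.subspace_scale[OF sub] abI abm)
    also have "\<dots> = (\<Sum>i\<in>I. f (a i) (scale_op (u i) (b m)))"
      by (intro sum.cong refl f_scale abI abm)
    finally show ?thesis .
  qed
  also have "\<dots> + (\<Sum>i\<in>I. f (a i) (b i)) = (\<Sum>i\<in>I. f (a i) (scale_op (u i) (b m) + b i))"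
    unfolding sum.distrib[symmetric]
    by (intro sum.cong refl f_add[symmetric] ops.subspace_scale[OF sub] abI abm)
  finally have eq: "(\<Sum>i<Suc n. f (a i) (b i)) = (\<Sum>i\<in>I. f (a i) (scale_op (u i) (b m) + b i))" .
  \<comment> \<open>Renumbers the surviving indices as \<open>{..<n}\<close>.\<close>
  obtain h where h: "bij_betw h {..<n} I"
    using ex_bij_betw_nat_finite[OF I(1)] I(4) by (auto simp: lessThan_atLeast0)
  have "(\<Sum>i<Suc n. f (a i) (b i)) = (\<Sum>j<n. f (a (h j)) (scale_op (u (h j)) (b m) + b (h j)))"
    unfolding eq by (rule sum.reindex_bij_betw[OF h, symmetric])
  moreover have "\<forall>j<n. a (h j) \<in> M \<and> scale_op (u (h j)) (b m) + b (h j) \<in> M"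
    using h abI abm
    by (auto simp: bij_betw_def intro!: ops.subspace_add[OF sub] ops.subspace_scale[OF sub])
  ultimately show ?thesis
    by (intro exI[of _ "\<lambda>j. a (h j)"] exI[of _ "\<lambda>j. scale_op (u (h j)) (b m) + b (h j)"]) simp
qed

text \<open>With the least number of terms neither leg can be dependent, since
  \<open>bilinear_sum_shorten\<close> would remove a term.\<close>

lemma alg_tensor_minimal_repr:
  fixes t :: "'h::chilbert_space \<Rightarrow> 'h \<Rightarrow> 'k::chilbert_space"
  assumes sub: "ops.subspace M" and M: "M \<subseteq> bop" and t: "hilbert_tensor t"
    and X: "X \<in> alg_tensor t M M"
  shows "\<exists>n a b. (\<forall>i<n. a i \<in> M \<and> b i \<in> M) \<and> X = (\<Sum>i<n. op_tensor t (a i) (b i)) \<and>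
    op_independent n a \<and> op_independent n b"
proof -
  interpret htensor t by unfold_locales (rule t)
  define Q where "Q n \<longleftrightarrow> (\<exists>a b. (\<forall>i<n. a i \<in> M \<and> b i \<in> M) \<and> X = (\<Sum>i<n. op_tensor t (a i) (b i)))"
    for n :: nat
  have "\<exists>n. Q n" unfolding Q_def
    by (rule alg_tensor_repr[OF _ M M t X]) (rule ops.subspace_scale[OF sub])
  then have Q: "Q (LEAST n. Q n)" by (rule LeastI_ex)
  define n where "n = (LEAST n. Q n)"
  have min: "\<not> Q k" if "k < n" for k using that not_less_Least unfolding n_def by blast
  have "Q n" using Q unfolding n_def .
  then obtain a b where ab: "\<forall>i<n. a i \<in> M \<and> b i \<in> M" and X: "X = (\<Sum>i<n. op_tensor t (a i) (b i))"
    unfolding Q_def by blast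
  have bop: "x \<in> bop" if "x \<in> M" for x using that M by auto
  have "op_independent n a"
  proof (rule ccontr)
    assume dep: "\<not> op_independent n a"
    then have "n \<noteq> 0" by (auto simp: op_independent_def)
    then obtain n' where n': "n = Suc n'" using not0_implies_Suc by blast
    have "\<exists>a' b'. (\<forall>i<n'. a' i \<in> M \<and> b' i \<in> M) \<and>
        (\<Sum>i<Suc n'. op_tensor t (a i) (b i)) = (\<Sum>i<n'. op_tensor t (a' i) (b' i))"
      by (rule bilinear_sum_shorten[OF sub])
        (use ab dep bop in \<open>simp_all add: n' op_tensor_sum_left op_tensor_add_right
          op_tensor_scale_left op_tensor_scale_right\<close>)
    then have "Q n'" unfolding Q_def X n' .
    then show False using min[of n'] n' by simp
  qed
  moreover have "op_independent n b"
  proof (rule ccontr)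
    assume dep: "\<not> op_independent n b"
    then have "n \<noteq> 0" by (auto simp: op_independent_def)
    then obtain n' where n': "n = Suc n'" using not0_implies_Suc by blast
    have "\<exists>b' a'. (\<forall>i<n'. b' i \<in> M \<and> a' i \<in> M) \<and>
        (\<Sum>i<Suc n'. op_tensor t (a i) (b i)) = (\<Sum>i<n'. op_tensor t (a' i) (b' i))"
      by (rule bilinear_sum_shorten[OF sub, of "\<lambda>b a. op_tensor t a b"])
        (use ab dep bop in \<open>simp_all add: n' op_tensor_sum_right op_tensor_add_left
          op_tensor_scale_left op_tensor_scale_right\<close>)
    then have "Q n'" unfolding Q_def X n' by blast
    then show False using min[of n'] n' by simp
  qed
  ultimately show ?thesis using ab X by blast
qed

text \<open>Associativity of matrix products: \<open>V = V (c W) = (V c) W = W\<close>.\<close>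

lemma op_matrix_inverse_unique:
  fixes V W c :: "nat \<Rightarrow> nat \<Rightarrow> 'a::real_normed_vector \<Rightarrow>\<^sub>L 'a"
  assumes Vc: "\<And>i j. i < n \<Longrightarrow> j < n \<Longrightarrow> (\<Sum>k<n. V i k o\<^sub>L c k j) = (if i = j then id_blinfun else 0)"
    and cW: "\<And>i j. i < n \<Longrightarrow> j < n \<Longrightarrow> (\<Sum>k<n. c i k o\<^sub>L W k j) = (if i = j then id_blinfun else 0)"
    and ij: "i < n" "j < n"
  shows "V i j = W i j"
proof -
  have "V i j = (\<Sum>k<n. if k = j then V i j else 0)" using ij by simp
  also have "\<dots> = (\<Sum>k<n. V i k o\<^sub>L (if k = j then id_blinfun else 0))"
    by (intro sum.cong) auto
  also have "\<dots> = (\<Sum>k<n. V i k o\<^sub>L (\<Sum>l<n. c k l o\<^sub>L W l j))"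
    using ij by (intro sum.cong refl) (simp add: cW)
  also have "\<dots> = (\<Sum>l<n. (\<Sum>k<n. V i k o\<^sub>L c k l) o\<^sub>L W l j)"
    by (simp add: comp_sum_left comp_sum_right comp_assoc) (rule sum.swap)
  also have "\<dots> = (\<Sum>l<n. (if i = l then id_blinfun else 0) o\<^sub>L W l j)"
    using ij by (intro sum.cong refl) (simp add: Vc)
  also have "\<dots> = (\<Sum>l<n. if l = i then W i j else 0)"
    by (intro sum.cong) auto
  also have "\<dots> = W i j" using ij by simp
  finally show ?thesis .
qed

text \<open>The columns are linearly independent over the scalars. This is weaker than invertibility
  of the operator matrix; invariance of the Haar state supplies the rest.\<close>

definition nondegenerate :: "nat \<Rightarrow> (nat \<Rightarrow> nat \<Rightarrow> 'a::chilbert_space \<Rightarrow>\<^sub>L 'a) \<Rightarrow> bool" where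
  "nondegenerate n c \<longleftrightarrow>
     (\<forall>v. (\<forall>i<n. (\<Sum>j<n. scale_op (v j) (c i j)) = 0) \<longrightarrow> (\<forall>j<n. v j = 0))"

lemma nondegenerate_adj:
  assumes "nondegenerate n c" "\<And>i j. i < n \<Longrightarrow> j < n \<Longrightarrow> c i j \<in> bop"
  shows "nondegenerate n (\<lambda>i j. adj (c i j))"
  unfolding nondegenerate_def
proof (intro allI impI)
  fix v j
  assume v: "\<forall>i<n. (\<Sum>j<n. scale_op (v j) (adj (c i j))) = 0" and j: "j < n"
  have "(\<Sum>j<n. scale_op (cnj (v j)) (c i j)) = 0" if "i < n" for i
  proof -
    have "adj (\<Sum>j<n. scale_op (v j) (adj (c i j))) = (\<Sum>j<n. adj (scale_op (v j) (adj (c i j))))"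
      using that assms(2) by (intro adj_sum scale_bop adj_bop) auto
    also have "\<dots> = (\<Sum>j<n. scale_op (cnj (v j)) (c i j))"
      using that assms(2) by (intro sum.cong refl) (simp add: adj_scale)
    finally have "adj (\<Sum>j<n. scale_op (v j) (adj (c i j))) = (\<Sum>j<n. scale_op (cnj (v j)) (c i j))" .
    then show ?thesis using v that by simp
  qed
  then have "cnj (v j) = 0"
    using assms(1)[unfolded nondegenerate_def, THEN spec[of _ "\<lambda>j. cnj (v j)"]] j by simp
  then show "v j = 0" by simp
qed


section \<open>Corepresentations of a compact quantum group\<close>

context compact_quantum_group
begin

abbreviation M where "M \<equiv> L_infty A"

abbreviation tens :: "('h \<Rightarrow>\<^sub>L 'h) \<Rightarrow> ('h \<Rightarrow>\<^sub>L 'h) \<Rightarrow> ('k \<Rightarrow>\<^sub>L 'k)" (infixr "\<boxtimes>" 75)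
  where "a \<boxtimes> b \<equiv> op_tensor t a b"

interpretation tn: htensor t by unfold_locales (rule tensor)
interpretation tl: htensor tL by unfold_locales (rule tensor)
interpretation tr: htensor tR by unfold_locales (rule tensor)

section \<open>Basic properties of the two algebras and of the coproduct\<close>

lemma A_bop: "A \<subseteq> bop" and A_closed: "closed A" and A_adj: "a \<in> A \<Longrightarrow> adj a \<in> A"
  and A_subspace: "ops.subspace A"
proof -
  show sub: "A \<subseteq> bop" and "closed A" and "a \<in> A \<Longrightarrow> adj a \<in> A"
    using algebra_C by (auto simp: unital_cstar_algebra_def)
  have id: "id_blinfun \<in> A" and "\<And>c a. a \<in> A \<Longrightarrow> scale_op c a \<in> A"
    and "\<And>a b. a \<in> A \<Longrightarrow> b \<in> A \<Longrightarrow> a + b \<in> A"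
    using algebra_C by (auto simp: unital_cstar_algebra_def)
  moreover have "scale_op 0 id_blinfun \<in> A" by (intro calculation)
  ultimately show "ops.subspace A" by (simp add: ops.subspace_def)
qed

lemma commutant_A_bop: "commutant A \<subseteq> bop"
  using commutant_bop by blast

lemma M_bop: "x \<in> M \<Longrightarrow> x \<in> bop" and M_subspace: "ops.subspace M" and M_id: "id_blinfun \<in> M"
  and M_comp: "x \<in> M \<Longrightarrow> y \<in> M \<Longrightarrow> x o\<^sub>L y \<in> M" and M_adj: "x \<in> M \<Longrightarrow> adj x \<in> M"
proof -
  show "x \<in> M \<Longrightarrow> x \<in> bop" unfolding L_infty_def by (rule commutant_bop)
  show "ops.subspace M" unfolding L_infty_def by (rule commutant_subspace[OF commutant_A_bop])
  show "id_blinfun \<in> M" unfolding L_infty_def by (rule id_commutant)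
  show "x \<in> M \<Longrightarrow> y \<in> M \<Longrightarrow> x o\<^sub>L y \<in> M" unfolding L_infty_def by (rule comp_commutant)
  have "adj s \<in> commutant A" if "s \<in> commutant A" for s
    by (rule adj_commutant[OF A_bop A_adj that])
  then show "x \<in> M \<Longrightarrow> adj x \<in> M"
    unfolding L_infty_def by (rule adj_commutant[OF commutant_A_bop])
qed

lemmas M_sum = ops.subspace_sum[OF M_subspace]
  and M_scale = ops.subspace_scale[OF M_subspace]

lemma M_subset_bop: "M \<subseteq> bop"
  using M_bop by blast

lemma A_subset_M: "A \<subseteq> M"
  unfolding L_infty_def by (rule subset_bicommutant[OF A_bop])

lemma alg_tensor_vn_tensor:
  assumes "hilbert_tensor s" "N \<subseteq> bop" "N' \<subseteq> bop"
  shows "alg_tensor s N N' \<subseteq> vn_tensor s N N'"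
  unfolding vn_tensor_def
  by (intro subset_bicommutant htensor.alg_tensor_bop htensor.intro assms)

lemma tens_vn_tensor: "x \<in> M \<Longrightarrow> y \<in> M \<Longrightarrow> x \<boxtimes> y \<in> vn_tensor t M M"
  using alg_tensor_vn_tensor[OF tensor(1) M_subset_bop M_subset_bop]
  by (auto simp: alg_tensor_def intro!: ops.span_base)

lemma Delta_vn_tensor: "x \<in> M \<Longrightarrow> \<Delta> x \<in> vn_tensor t M M"
  using coproduct by (auto simp: normal_unital_star_hom_def)

lemma Delta_bop: "x \<in> M \<Longrightarrow> \<Delta> x \<in> bop"
  using Delta_vn_tensor commutant_bop unfolding vn_tensor_def by blast

lemma Delta_id: "\<Delta> id_blinfun = id_blinfun"
  and Delta_add: "x \<in> M \<Longrightarrow> y \<in> M \<Longrightarrow> \<Delta> (x + y) = \<Delta> x + \<Delta> y"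
  and Delta_comp: "x \<in> M \<Longrightarrow> y \<in> M \<Longrightarrow> \<Delta> (x o\<^sub>L y) = \<Delta> x o\<^sub>L \<Delta> y"
  and Delta_scale: "x \<in> M \<Longrightarrow> \<Delta> (scale_op c x) = scale_op c (\<Delta> x)"
  and Delta_adj: "x \<in> M \<Longrightarrow> \<Delta> (adj x) = adj (\<Delta> x)"
  using coproduct by (auto simp: normal_unital_star_hom_def)

lemma Delta_sum: "(\<And>i. i \<in> I \<Longrightarrow> f i \<in> M) \<Longrightarrow> \<Delta> (sum f I) = (\<Sum>i\<in>I. \<Delta> (f i))"
  using star_hom_sum[OF coproduct[unfolded L_infty_def] commutant_A_bop] unfolding L_infty_def .

lemma Delta_zero: "\<Delta> 0 = 0"
  using Delta_sum[of "{}" "\<lambda>_. 0"] by simp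

section \<open>Consequences of faithfulness and invariance of the Haar state, and
  coassociativity\<close>

lemma cinner_Omega: "cinner \<Omega> \<Omega> = 1"
  using state by (simp add: cinner_self)

text \<open>The Haar state of \<open>adj x o\<^sub>L x\<close> is the squared norm of
  \<open>x \<Omega>\<close>, so faithfulness makes \<open>\<Omega>\<close> separating. Independence
  of operators can thus be tested on vectors.\<close>

lemma separating: "x \<in> M \<Longrightarrow> x \<Omega> = 0 \<Longrightarrow> x = 0"
  by (rule faithful) (simp_all add: haar_def blinfun.zero_right)

text \<open>Invariance is applied to \<open>adj y o\<^sub>L x\<close>; since \<open>\<Delta>\<close>
  respects products and adjoints, one factor moves to the other side of the inner product.\<close>

lemma cinner_Delta_right:
  assumes "x \<in> M" "y \<in> M"
  shows "cinner (\<Delta> x (t \<Omega> \<xi>)) (\<Delta> y (t \<Omega> \<eta>)) = cinner (x \<Omega>) (y \<Omega>) * cinner \<xi> \<eta>"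
proof -
  have "cinner (\<Delta> x (t \<Omega> \<xi>)) (\<Delta> y (t \<Omega> \<eta>)) = cinner (\<Delta> (adj y o\<^sub>L x) (t \<Omega> \<xi>)) (t \<Omega> \<eta>)"
    using assms by (simp add: Delta_comp M_adj Delta_adj cinner_adj_left Delta_bop)
  also have "\<dots> = haar \<Omega> (adj y o\<^sub>L x) * cinner \<xi> \<eta>"
    by (rule right_invariant) (intro M_comp M_adj assms)
  finally show ?thesis using assms by (simp add: haar_def cinner_adj_left M_bop)
qed

lemma cinner_Delta_left:
  assumes "x \<in> M" "y \<in> M"
  shows "cinner (\<Delta> x (t \<xi> \<Omega>)) (\<Delta> y (t \<eta> \<Omega>)) = cinner (x \<Omega>) (y \<Omega>) * cinner \<xi> \<eta>"
proof -
  have "cinner (\<Delta> x (t \<xi> \<Omega>)) (\<Delta> y (t \<eta> \<Omega>)) = cinner (\<Delta> (adj y o\<^sub>L x) (t \<xi> \<Omega>)) (t \<eta> \<Omega>)"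
    using assms by (simp add: Delta_comp M_adj Delta_adj cinner_adj_left Delta_bop)
  also have "\<dots> = haar \<Omega> (adj y o\<^sub>L x) * cinner \<xi> \<eta>"
    by (rule left_invariant) (intro M_comp M_adj assms)
  finally show ?thesis using assms by (simp add: haar_def cinner_adj_left M_bop)
qed

text \<open>By invariance \<open>x \<Omega>\<close> and
  \<open>\<Delta> x (t \<Omega> \<Omega>)\<close> have the same norm, and \<open>\<Omega>\<close> is
  separating.\<close>

lemma Delta_injective:
  assumes "x \<in> M" "\<Delta> x = 0"
  shows "x = 0"
proof -
  have "cinner (x \<Omega>) (x \<Omega>) = 0"
    using cinner_Delta_left[OF assms(1) assms(1), of \<Omega> \<Omega>] assms(2)
    by (simp add: cinner_Omega)
  then show ?thesis using separating[OF assms(1)] by simp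
qed

lemma Delta_eq_imp_eq:
  assumes "x \<in> M" "y \<in> M" "\<Delta> x = \<Delta> y"
  shows "x = y"
proof -
  have "\<Delta> (x + scale_op (- 1) y) = \<Delta> x + scale_op (- 1) (\<Delta> y)"
    by (simp only: Delta_add Delta_scale M_scale assms)
  then have "x + scale_op (- 1) y = 0"
    by (intro Delta_injective ops.subspace_add[OF M_subspace] M_scale assms) (simp add: assms)
  then show ?thesis by simp
qed

text \<open>Coassociativity read on matrix coefficients. The extensions \<open>\<Phi>\<close>,
  \<open>\<Psi>\<close> and the triple tensor product are confined to this proof; later arguments
  use the scalar identity.\<close>

lemma coassociative_form:
  assumes x: "x \<in> M" and pq: "\<And>k. k < (n::nat) \<Longrightarrow> p k \<in> M \<and> q k \<in> M"
    and \<Delta>x: "\<Delta> x = (\<Sum>k<n. p k \<boxtimes> q k)"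
  shows "(\<Sum>k<n. cinner (\<Delta> (p k) (t \<alpha> \<beta>)) (t \<alpha>' \<beta>') * cinner (q k \<gamma>) \<gamma>') =
    (\<Sum>k<n. cinner (p k \<alpha>) \<alpha>' * cinner (\<Delta> (q k) (t \<beta> \<gamma>)) (t \<beta>' \<gamma>'))"
proof -
  from coassociative obtain \<Phi> \<Psi> where
    \<Phi>: "is_tensor_id_right t tL M \<Delta> \<Phi>" and \<Psi>: "is_tensor_id_left t tR M \<Delta> \<Psi>"
    and eq: "\<And>x. x \<in> M \<Longrightarrow> \<Phi> (\<Delta> x) = \<Psi> (\<Delta> x)" by blast
  have sub: "commutant (alg_tensor t M M) \<subseteq> bop" using commutant_bop by blast
  have vn: "p k \<boxtimes> q k \<in> commutant (commutant (alg_tensor t M M))" if "k < n" for k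
    using tens_vn_tensor pq[OF that] unfolding vn_tensor_def by blast
  have "\<Phi> (\<Delta> x) = (\<Sum>k<n. \<Phi> (p k \<boxtimes> q k))" unfolding \<Delta>x
    by (rule star_hom_sum[OF _ sub])
      (use \<Phi> vn in \<open>auto simp: is_tensor_id_right_def vn_tensor_def\<close>)
  also have "\<dots> = (\<Sum>k<n. op_tensor tL (\<Delta> (p k)) (q k))"
    using \<Phi> pq by (intro sum.cong) (auto simp: is_tensor_id_right_def)
  finally have L: "\<Phi> (\<Delta> x) = (\<Sum>k<n. op_tensor tL (\<Delta> (p k)) (q k))" .
  have "\<Psi> (\<Delta> x) = (\<Sum>k<n. \<Psi> (p k \<boxtimes> q k))" unfolding \<Delta>x
    by (rule star_hom_sum[OF _ sub])
      (use \<Psi> vn in \<open>auto simp: is_tensor_id_left_def vn_tensor_def\<close>)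
  also have "\<dots> = (\<Sum>k<n. op_tensor tR (p k) (\<Delta> (q k)))"
    using \<Psi> pq by (intro sum.cong) (auto simp: is_tensor_id_left_def)
  finally have R: "\<Psi> (\<Delta> x) = (\<Sum>k<n. op_tensor tR (p k) (\<Delta> (q k)))" .
  have "(\<Sum>k<n. cinner (\<Delta> (p k) (t \<alpha> \<beta>)) (t \<alpha>' \<beta>') * cinner (q k \<gamma>) \<gamma>')
      = cinner (\<Phi> (\<Delta> x) (tL (t \<alpha> \<beta>) \<gamma>)) (tL (t \<alpha>' \<beta>') \<gamma>')"
    using pq by (simp add: L blinfun.sum_left cinner_sum_left tl.op_tensor_apply Delta_bop M_bop tl.cinner_t)
  also have "\<dots> = cinner (\<Psi> (\<Delta> x) (tR \<alpha> (t \<beta> \<gamma>))) (tR \<alpha>' (t \<beta>' \<gamma>'))"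
    by (simp add: eq x tensor_assoc)
  also have "\<dots> = (\<Sum>k<n. cinner (p k \<alpha>) \<alpha>' * cinner (\<Delta> (q k) (t \<beta> \<gamma>)) (t \<beta>' \<gamma>'))"
    using pq by (simp add: R blinfun.sum_left cinner_sum_left tr.op_tensor_apply Delta_bop M_bop tr.cinner_t)
  finally show ?thesis .
qed

lemma sum_tens_bop:
  "(\<And>i. i \<in> I \<Longrightarrow> p i \<in> M \<and> q i \<in> M) \<Longrightarrow> (\<Sum>i\<in>I. p i \<boxtimes> q i) \<in> bop"
  by (intro sum_bop tn.op_tensor_bop) (auto simp: M_bop)

lemma cinner_sum_tens:
  assumes "\<And>i. i \<in> I \<Longrightarrow> p i \<in> M \<and> q i \<in> M"
  shows "cinner ((\<Sum>i\<in>I. p i \<boxtimes> q i) (t \<alpha> \<beta>)) (t \<alpha>' \<beta>')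
    = (\<Sum>i\<in>I. cinner (p i \<alpha>) \<alpha>' * cinner (q i \<beta>) \<beta>')"
  using assms by (simp add: blinfun.sum_left cinner_sum_left tn.op_tensor_apply M_bop tn.cinner_t)

text \<open>Writing \<open>P\<close> for the positive matrix \<open>h(X\<^sup>* X)\<close>, the hypothesis \<open>form\<close> says \<open>P = X\<^sup>* P X\<close>,
  so that \<open>P\<^sup>-\<^sup>1 X\<^sup>* P\<close> is a left inverse of \<open>X\<close>.\<close>

lemma left_inverse_of_form:
  assumes XM: "\<And>i j. i < n \<Longrightarrow> j < n \<Longrightarrow> X i j \<in> M" and nd: "nondegenerate n X"
    and form: "\<And>i j \<xi> \<eta>. i < n \<Longrightarrow> j < n \<Longrightarrow>
      (\<Sum>k<n. cinner (X k j \<Omega>) (X k i \<Omega>)) * cinner \<xi> \<eta> =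
      (\<Sum>b<n. \<Sum>a<n. (\<Sum>k<n. cinner (X k b \<Omega>) (X k a \<Omega>)) * cinner (X b j \<xi>) (X a i \<eta>))"
  shows "\<exists>V. (\<forall>i<n. \<forall>j<n. V i j \<in> cspan_op {adj (X k l) | k l. k < n \<and> l < n}) \<and>
    (\<forall>i<n. \<forall>j<n. (\<Sum>k<n. V i k o\<^sub>L X k j) = (if i = j then id_blinfun else 0))"
proof -
  define P where "P a b = (\<Sum>k<n. cinner (X k b \<Omega>) (X k a \<Omega>))" for a b
  \<comment> \<open>Invertibility of \<open>P\<close>: a kernel vector annihilates the vectors
    \<open>X k i \<Omega>\<close>, hence the operators because \<open>\<Omega>\<close> separates, so
    it vanishes by nondegeneracy.\<close>
  have "\<exists>H. \<forall>i<n. \<forall>j<n.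
    (\<Sum>k<n. (\<Sum>l<n. cinner (X l k \<Omega>) (X l i \<Omega>)) * H k j) = (if i = j then 1 else 0) \<and>
    (\<Sum>k<n. H i k * (\<Sum>l<n. cinner (X l j \<Omega>) (X l k \<Omega>))) = (if i = j then 1 else 0)"
  proof (rule gram_inverse_exists)
    fix v i assume v: "\<And>k. k < n \<Longrightarrow> (\<Sum>i<n. v i *\<^sub>C X k i \<Omega>) = 0" and i: "i < n"
    have "(\<Sum>i<n. scale_op (v i) (X k i)) = 0" if "k < n" for k
      by (rule separating) (use v that XM in \<open>auto simp: blinfun.sum_left intro!: M_sum M_scale\<close>)
    then show "v i = 0" using nd[unfolded nondegenerate_def] i by blast
  qed
  then obtain G where G: "\<And>i j. i < n \<Longrightarrow> j < n \<Longrightarrow> (\<Sum>k<n. G i k * P k j) = (if i = j then 1 else 0)"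
    unfolding P_def by blast
  \<comment> \<open>Entrywise \<open>P\<^sup>-\<^sup>1 X\<^sup>* P\<close>: \<open>G\<close> inverts
    \<open>P\<close>, and \<open>adj (X a r)\<close> is the entry of \<open>X\<^sup>*\<close> in row
    \<open>r\<close> and column \<open>a\<close>.\<close>
  define V where "V i j = (\<Sum>r<n. \<Sum>a<n. scale_op (G i r * P a j) (adj (X a r)))" for i j
  have "V i j \<in> cspan_op {adj (X k l) | k l. k < n \<and> l < n}" for i j
    unfolding V_def by (intro ops.span_sum ops.span_scale ops.span_base) auto
  moreover have "(\<Sum>j<n. V i j o\<^sub>L X j l) = (if i = l then id_blinfun else 0)" if il: "i < n" "l < n" for i l
  proof (rule op_eqI)
    fix \<xi> \<eta>
    have "cinner ((\<Sum>j<n. V i j o\<^sub>L X j l) \<xi>) \<eta>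
        = (\<Sum>j<n. \<Sum>r<n. \<Sum>a<n. G i r * P a j * cinner (adj (X a r) (X j l \<xi>)) \<eta>)"
      by (simp add: V_def blinfun.sum_left cinner_simps)
    also have "\<dots> = (\<Sum>j<n. \<Sum>r<n. \<Sum>a<n. G i r * (P a j * cinner (X j l \<xi>) (X a r \<eta>)))"
      by (intro sum.cong refl) (simp add: cinner_adj_left XM M_bop mult.assoc)
    also have "\<dots> = (\<Sum>r<n. \<Sum>j<n. \<Sum>a<n. G i r * (P a j * cinner (X j l \<xi>) (X a r \<eta>)))"
      by (rule sum.swap)
    also have "\<dots> = (\<Sum>r<n. G i r * (P r l * cinner \<xi> \<eta>))"
    proof (intro sum.cong refl)
      fix r assume "r \<in> {..<n}"
      then have "P r l * cinner \<xi> \<eta> = (\<Sum>j<n. \<Sum>a<n. P a j * cinner (X j l \<xi>) (X a r \<eta>))"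
        unfolding P_def using il by (intro form) auto
      then show "(\<Sum>j<n. \<Sum>a<n. G i r * (P a j * cinner (X j l \<xi>) (X a r \<eta>))) = G i r * (P r l * cinner \<xi> \<eta>)"
        by (simp add: sum_distrib_left)
    qed
    also have "\<dots> = (if i = l then 1 else 0) * cinner \<xi> \<eta>"
      unfolding G[OF il, symmetric] by (simp add: sum_distrib_right mult.assoc)
    finally show "cinner ((\<Sum>j<n. V i j o\<^sub>L X j l) \<xi>) \<eta>
        = cinner ((if i = l then id_blinfun else 0) \<xi>) \<eta>" by auto
  qed
  ultimately show ?thesis by blast
qed

section \<open>Invertibility of corepresentations and of their transposes\<close>

lemma corep_M:
  assumes "corepresentation t M \<Delta> n c" "i < n" "j < n"
  shows "c i j \<in> M" "\<Delta> (c i j) = (\<Sum>k<n. c i k \<boxtimes> c k j)"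
  using assms by (auto simp: corepresentation_def)

text \<open>Adjoints keep the order of tensor legs, so the entrywise conjugate, as opposed to the
  conjugate transpose, is again a corepresentation.\<close>

lemma corep_adj:
  assumes c: "corepresentation t M \<Delta> n c"
  shows "corepresentation t M \<Delta> n (\<lambda>i j. adj (c i j))"
proof -
  have "\<Delta> (adj (c i j)) = (\<Sum>k<n. adj (c i k) \<boxtimes> adj (c k j))" if ij: "i < n" "j < n" for i j
  proof -
    have "\<Delta> (adj (c i j)) = adj (\<Sum>k<n. c i k \<boxtimes> c k j)"
      by (simp add: Delta_adj corep_M[OF c] ij)
    also have "\<dots> = (\<Sum>k<n. adj (c i k \<boxtimes> c k j))"
      by (intro adj_sum tn.op_tensor_bop M_bop) (auto simp: corep_M[OF c] ij)
    also have "\<dots> = (\<Sum>k<n. adj (c i k) \<boxtimes> adj (c k j))"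
      by (intro sum.cong refl tn.adj_op_tensor M_bop) (auto simp: corep_M[OF c] ij)
    finally show ?thesis .
  qed
  then show ?thesis using c by (auto simp: corepresentation_def M_adj)
qed

text \<open>Right invariance gives a left inverse of \<open>c\<close>. Left invariance gives a left
  inverse of the conjugate transpose, whose adjoint is a right inverse of \<open>c\<close>; the two
  coincide. The span clause places the inverse in every subspace that contains the adjoints of the
  entries of \<open>c\<close>.\<close>

lemma corep_inverse_exists:
  assumes c: "corepresentation t M \<Delta> n c"
    and nd: "nondegenerate n c" "nondegenerate n (\<lambda>i j. c j i)"
  shows "\<exists>V. (\<forall>i<n. \<forall>j<n. V i j \<in> cspan_op {adj (c k l) | k l. k < n \<and> l < n}) \<and>
    (\<forall>i<n. \<forall>j<n. (\<Sum>k<n. V i k o\<^sub>L c k j) = (if i = j then id_blinfun else 0)) \<and>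
    (\<forall>i<n. \<forall>j<n. (\<Sum>k<n. c i k o\<^sub>L V k j) = (if i = j then id_blinfun else 0))"
proof -
  note cM = corep_M[OF c]
  note dM = corep_M[OF corep_adj[OF c]]
  have "\<exists>V. (\<forall>i<n. \<forall>j<n. V i j \<in> cspan_op {adj (c k l) | k l. k < n \<and> l < n}) \<and>
    (\<forall>i<n. \<forall>j<n. (\<Sum>k<n. V i k o\<^sub>L c k j) = (if i = j then id_blinfun else 0))"
  proof (rule left_inverse_of_form[OF cM(1) nd(1)])
    fix i j \<xi> \<eta> assume ij: "i < n" "j < n"
    have "(\<Sum>k<n. cinner (c k j \<Omega>) (c k i \<Omega>)) * cinner \<xi> \<eta>
        = (\<Sum>k<n. cinner (\<Delta> (c k j) (t \<Omega> \<xi>)) (\<Delta> (c k i) (t \<Omega> \<eta>)))"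
      unfolding sum_distrib_right by (intro sum.cong refl) (simp add: cinner_Delta_right cM(1) ij)
    also have "\<dots> = (\<Sum>k<n. \<Sum>b<n. \<Sum>a<n.
        cinner (c k b \<Omega>) (c k a \<Omega>) * cinner (c b j \<xi>) (c a i \<eta>))"
    proof (intro sum.cong refl)
      fix k assume "k \<in> {..<n}"
      then have k: "k < n" by simp
      have *: "\<Delta> (c k j) (t \<Omega> \<xi>) = (\<Sum>b<n. t (c k b \<Omega>) (c b j \<xi>))" if "j < n" for j \<xi>
        using k that by (simp add: cM blinfun.sum_left tn.op_tensor_apply M_bop)
      show "cinner (\<Delta> (c k j) (t \<Omega> \<xi>)) (\<Delta> (c k i) (t \<Omega> \<eta>)) = (\<Sum>b<n. \<Sum>a<n.
        cinner (c k b \<Omega>) (c k a \<Omega>) * cinner (c b j \<xi>) (c a i \<eta>))"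
        unfolding *[OF ij(1)] *[OF ij(2)] unfolding cinner_sum_left unfolding cinner_sum_right tn.cinner_t ..
    qed
    also have "\<dots> = (\<Sum>b<n. \<Sum>k<n. \<Sum>a<n.
        cinner (c k b \<Omega>) (c k a \<Omega>) * cinner (c b j \<xi>) (c a i \<eta>))" by (rule sum.swap)
    also have "\<dots> = (\<Sum>b<n. \<Sum>a<n. (\<Sum>k<n. cinner (c k b \<Omega>) (c k a \<Omega>)) * cinner (c b j \<xi>) (c a i \<eta>))"
      unfolding sum_distrib_right by (rule sum.cong[OF refl]) (rule sum.swap)
    finally show "(\<Sum>k<n. cinner (c k j \<Omega>) (c k i \<Omega>)) * cinner \<xi> \<eta> = \<dots>" .
  qed
  then obtain V where V: "\<And>i j. i < n \<Longrightarrow> j < n \<Longrightarrow> V i j \<in> cspan_op {adj (c k l) | k l. k < n \<and> l < n}"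
    "\<And>i j. i < n \<Longrightarrow> j < n \<Longrightarrow> (\<Sum>k<n. V i k o\<^sub>L c k j) = (if i = j then id_blinfun else 0)"
    by blast
  \<comment> \<open>Transposing reverses the legs in the coproduct formula, which is why left
    invariance takes over below.\<close>
  define X where "X i j = adj (c j i)" for i j
  have XM: "X i j \<in> M" if "i < n" "j < n" for i j
    using that by (simp add: X_def cM M_adj)
  have "\<exists>Y. (\<forall>i<n. \<forall>j<n. Y i j \<in> cspan_op {adj (X k l) | k l. k < n \<and> l < n}) \<and>
    (\<forall>i<n. \<forall>j<n. (\<Sum>k<n. Y i k o\<^sub>L X k j) = (if i = j then id_blinfun else 0))"
  proof (rule left_inverse_of_form[OF XM])
    show "nondegenerate n X"
      unfolding X_def by (rule nondegenerate_adj[OF nd(2)]) (simp add: cM M_bop)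
    fix i j \<xi> \<eta> assume ij: "i < n" "j < n"
    have "(\<Sum>k<n. cinner (X k j \<Omega>) (X k i \<Omega>)) * cinner \<xi> \<eta>
        = (\<Sum>k<n. cinner (\<Delta> (X k j) (t \<xi> \<Omega>)) (\<Delta> (X k i) (t \<eta> \<Omega>)))"
      unfolding sum_distrib_right by (intro sum.cong refl) (simp add: cinner_Delta_left XM ij)
    also have "\<dots> = (\<Sum>k<n. \<Sum>b<n. \<Sum>a<n.
        cinner (X k b \<Omega>) (X k a \<Omega>) * cinner (X b j \<xi>) (X a i \<eta>))"
    proof (intro sum.cong refl)
      fix k assume "k \<in> {..<n}"
      then have k: "k < n" by simp
      have *: "\<Delta> (X k j) (t \<xi> \<Omega>) = (\<Sum>b<n. t (X b j \<xi>) (X k b \<Omega>))" if "j < n" for j \<xi>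
        unfolding X_def using k that by (simp add: dM blinfun.sum_left tn.op_tensor_apply M_bop)
      show "cinner (\<Delta> (X k j) (t \<xi> \<Omega>)) (\<Delta> (X k i) (t \<eta> \<Omega>)) = (\<Sum>b<n. \<Sum>a<n.
        cinner (X k b \<Omega>) (X k a \<Omega>) * cinner (X b j \<xi>) (X a i \<eta>))"
        unfolding *[OF ij(1)] *[OF ij(2)]
        unfolding cinner_sum_left unfolding cinner_sum_right tn.cinner_t
        by (simp only: mult.commute)
    qed
    also have "\<dots> = (\<Sum>b<n. \<Sum>k<n. \<Sum>a<n.
        cinner (X k b \<Omega>) (X k a \<Omega>) * cinner (X b j \<xi>) (X a i \<eta>))" by (rule sum.swap)
    also have "\<dots> = (\<Sum>b<n. \<Sum>a<n. (\<Sum>k<n. cinner (X k b \<Omega>) (X k a \<Omega>)) * cinner (X b j \<xi>) (X a i \<eta>))"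
      unfolding sum_distrib_right by (rule sum.cong[OF refl]) (rule sum.swap)
    finally show "(\<Sum>k<n. cinner (X k j \<Omega>) (X k i \<Omega>)) * cinner \<xi> \<eta> = \<dots>" .
  qed
  then obtain Y where Y0: "\<And>i j. i < n \<Longrightarrow> j < n \<Longrightarrow> Y i j \<in> cspan_op {adj (X k l) | k l. k < n \<and> l < n}"
    and YX: "\<And>i j. i < n \<Longrightarrow> j < n \<Longrightarrow> (\<Sum>k<n. Y i k o\<^sub>L X k j) = (if i = j then id_blinfun else 0)"
    by blast
  have Y: "Y i j \<in> bop" if "i < n" "j < n" for i j
  proof -
    have "cspan_op {adj (X k l) | k l. k < n \<and> l < n} \<subseteq> M"
      by (rule ops.span_minimal[OF _ M_subspace]) (auto simp: XM M_adj)
    then show ?thesis using Y0[OF that] M_bop by blast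
  qed
  have "(\<Sum>k<n. c i k o\<^sub>L adj (Y j k)) = (if i = j then id_blinfun else 0)" if ij: "i < n" "j < n" for i j
  proof -
    have "(\<Sum>k<n. c i k o\<^sub>L adj (Y j k)) = (\<Sum>k<n. adj (Y j k o\<^sub>L X k i))"
      by (intro sum.cong refl) (simp add: X_def adj_comp Y ij cM M_bop)
    also have "\<dots> = adj (\<Sum>k<n. Y j k o\<^sub>L X k i)"
      by (rule adj_sum[symmetric]) (simp add: comp_bop Y XM M_bop ij)
    finally show ?thesis by (simp add: YX ij)
  qed
  then have "V i j = adj (Y j i)" if "i < n" "j < n" for i j
    by (intro op_matrix_inverse_unique[OF V(2) _ that])
  then have "(\<Sum>k<n. c i k o\<^sub>L V k j) = (if i = j then id_blinfun else 0)" if "i < n" "j < n" for i j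
    using \<open>\<And>i j. i < n \<Longrightarrow> j < n \<Longrightarrow> (\<Sum>k<n. c i k o\<^sub>L adj (Y j k)) = (if i = j then id_blinfun else 0)\<close> that
    by simp
  with V show ?thesis by blast
qed

text \<open>\<open>B\<close> is kept general because the inverse is needed first over
  \<open>M\<close>, and over \<open>A\<close> once the entries of \<open>c\<close> are known to lie
  there.\<close>

lemma corep_invertible:
  assumes c: "corepresentation t M \<Delta> n c"
    and nd: "nondegenerate n c" "nondegenerate n (\<lambda>i j. c j i)"
    and B: "ops.subspace B" "\<And>x. x \<in> B \<Longrightarrow> adj x \<in> B" "\<And>i j. i < n \<Longrightarrow> j < n \<Longrightarrow> c i j \<in> B"
  shows "invertible_matrix B n c"
proof -
  have "cspan_op {adj (c k l) | k l. k < n \<and> l < n} \<subseteq> B"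
    by (rule ops.span_minimal[OF _ B(1)]) (use B in auto)
  moreover from corep_inverse_exists[OF c nd] obtain V
    where "\<forall>i<n. \<forall>j<n. V i j \<in> cspan_op {adj (c k l) | k l. k < n \<and> l < n}"
      "\<forall>i<n. \<forall>j<n. (\<Sum>k<n. V i k o\<^sub>L c k j) = (if i = j then id_blinfun else 0)"
      "\<forall>i<n. \<forall>j<n. (\<Sum>k<n. c i k o\<^sub>L V k j) = (if i = j then id_blinfun else 0)"
    by blast
  ultimately show ?thesis
    unfolding invertible_matrix_def by (intro exI[of _ V]) auto
qed

text \<open>The entrywise adjoint of \<open>c\<close> is inverted; taking adjoints reverses the
  products of entries and turns this into an inverse of the transpose.\<close>

lemma corep_transpose_invertible:
  assumes c: "corepresentation t M \<Delta> n c"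
    and nd: "nondegenerate n c" "nondegenerate n (\<lambda>i j. c j i)"
    and B: "ops.subspace B" "B \<subseteq> bop" "\<And>x. x \<in> B \<Longrightarrow> adj x \<in> B" "\<And>i j. i < n \<Longrightarrow> j < n \<Longrightarrow> c i j \<in> B"
  shows "invertible_matrix B n (\<lambda>i j. c j i)"
proof -
  have bop: "c i j \<in> bop" if "i < n" "j < n" for i j using that B by blast
  have "invertible_matrix B n (\<lambda>i j. adj (c i j))"
    by (rule corep_invertible[OF corep_adj[OF c] nondegenerate_adj[OF nd(1)] nondegenerate_adj[OF nd(2)] B(1,3)])
      (simp_all add: B bop)
  then obtain V where V: "\<And>i j. i < n \<Longrightarrow> j < n \<Longrightarrow> V i j \<in> B"
    "\<And>i j. i < n \<Longrightarrow> j < n \<Longrightarrow> (\<Sum>k<n. adj (c i k) o\<^sub>L V k j) = (if i = j then id_blinfun else 0)"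
    "\<And>i j. i < n \<Longrightarrow> j < n \<Longrightarrow> (\<Sum>k<n. V i k o\<^sub>L adj (c k j)) = (if i = j then id_blinfun else 0)"
    unfolding invertible_matrix_def by blast
  have Vb: "V i j \<in> bop" if "i < n" "j < n" for i j using V(1)[OF that] B(2) by blast
  have "(\<Sum>k<n. c k i o\<^sub>L adj (V j k)) = (if i = j then id_blinfun else 0)" if ij: "i < n" "j < n" for i j
  proof -
    have "(\<Sum>k<n. c k i o\<^sub>L adj (V j k)) = (\<Sum>k<n. adj (V j k o\<^sub>L adj (c k i)))"
      by (intro sum.cong refl) (simp add: adj_comp bop Vb ij)
    also have "\<dots> = adj (\<Sum>k<n. V j k o\<^sub>L adj (c k i))"
      by (rule adj_sum[symmetric]) (simp add: comp_bop bop Vb ij)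
    finally show ?thesis by (simp add: V ij)
  qed
  moreover have "(\<Sum>k<n. adj (V k i) o\<^sub>L c j k) = (if i = j then id_blinfun else 0)" if ij: "i < n" "j < n" for i j
  proof -
    have "(\<Sum>k<n. adj (V k i) o\<^sub>L c j k) = (\<Sum>k<n. adj (adj (c j k) o\<^sub>L V k i))"
      by (intro sum.cong refl) (simp add: adj_comp bop Vb ij)
    also have "\<dots> = adj (\<Sum>k<n. adj (c j k) o\<^sub>L V k i)"
      by (rule adj_sum[symmetric]) (simp add: comp_bop bop Vb ij)
    finally show ?thesis by (simp add: V ij)
  qed
  ultimately show ?thesis
    unfolding invertible_matrix_def using V(1) B(3)
    by (intro exI[of _ "\<lambda>i j. adj (V j i)"]) simp
qed

section \<open>The inverse matrix and membership of the entries in \<open>A\<close>\<close>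

text \<open>Inversion reverses the legs. The \<open>\<Delta> (V i j)\<close> are right inverse to
  the \<open>\<Delta> (c i j)\<close> by multiplicativity; the sums on the right form a left
  inverse, by cancelling \<open>V c\<close> in the first leg and then in the second. Hence the two
  agree.\<close>

lemma corep_inverse_Delta:
  fixes n :: nat
  assumes c: "corepresentation t M \<Delta> n c"
    and V: "\<And>i j. i < n \<Longrightarrow> j < n \<Longrightarrow> V i j \<in> M"
    and Vc: "\<And>i j. i < n \<Longrightarrow> j < n \<Longrightarrow> (\<Sum>k<n. V i k o\<^sub>L c k j) = (if i = j then id_blinfun else 0)"
    and cV: "\<And>i j. i < n \<Longrightarrow> j < n \<Longrightarrow> (\<Sum>k<n. c i k o\<^sub>L V k j) = (if i = j then id_blinfun else 0)"
    and ij: "i < n" "j < n"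
  shows "\<Delta> (V i j) = (\<Sum>k<n. V k j \<boxtimes> V i k)"
proof -
  note cM = corep_M[OF c]
  have "(\<Sum>k<n. V k j \<boxtimes> V i k) = \<Delta> (V i j)"
  proof (rule op_matrix_inverse_unique[where V = "\<lambda>i j. \<Sum>k<n. V k j \<boxtimes> V i k" and
        W = "\<lambda>i j. \<Delta> (V i j)" and c = "\<lambda>i j. \<Delta> (c i j)" and n = n])
    fix i j assume ij: "i < n" "j < n"
    have "(\<Sum>k<n. \<Delta> (c i k) o\<^sub>L \<Delta> (V k j)) = \<Delta> (\<Sum>k<n. c i k o\<^sub>L V k j)"
      using ij by (subst Delta_sum) (auto simp: Delta_comp cM(1) V intro!: M_comp sum.cong)
    then show "(\<Sum>k<n. \<Delta> (c i k) o\<^sub>L \<Delta> (V k j)) = (if i = j then id_blinfun else 0)"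
      by (simp add: cV ij Delta_id Delta_zero)
  next
    fix i l assume il: "i < n" "l < n"
    have "(\<Sum>j<n. (\<Sum>k<n. V k j \<boxtimes> V i k) o\<^sub>L \<Delta> (c j l))
        = (\<Sum>j<n. \<Sum>k<n. \<Sum>m<n. (V k j o\<^sub>L c j m) \<boxtimes> (V i k o\<^sub>L c m l))"
      unfolding comp_sum_left using il
      by (intro sum.cong refl) (simp add: cM comp_sum_right tn.op_tensor_comp V M_bop)
    also have "\<dots> = (\<Sum>k<n. \<Sum>j<n. \<Sum>m<n. (V k j o\<^sub>L c j m) \<boxtimes> (V i k o\<^sub>L c m l))"
      by (rule sum.swap)
    also have "\<dots> = (\<Sum>k<n. \<Sum>m<n. \<Sum>j<n. (V k j o\<^sub>L c j m) \<boxtimes> (V i k o\<^sub>L c m l))"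
      by (rule sum.cong[OF refl]) (rule sum.swap)
    also have "\<dots> = (\<Sum>k<n. \<Sum>m<n. if m = k then id_blinfun \<boxtimes> (V i k o\<^sub>L c k l) else 0)"
    proof (intro sum.cong refl)
      fix k m assume "k \<in> {..<n}" "m \<in> {..<n}"
      then have km: "k < n" "m < n" by auto
      have "(\<Sum>j<n. (V k j o\<^sub>L c j m) \<boxtimes> (V i k o\<^sub>L c m l)) = (\<Sum>j<n. V k j o\<^sub>L c j m) \<boxtimes> (V i k o\<^sub>L c m l)"
        by (rule tn.op_tensor_sum_left[symmetric]) (auto intro!: M_bop M_comp V cM(1) km il)
      then show "(\<Sum>j<n. (V k j o\<^sub>L c j m) \<boxtimes> (V i k o\<^sub>L c m l))
          = (if m = k then id_blinfun \<boxtimes> (V i k o\<^sub>L c k l) else 0)"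
        by (auto simp: Vc km il comp_bop V cM(1) M_bop)
    qed
    also have "\<dots> = (\<Sum>k<n. id_blinfun \<boxtimes> (V i k o\<^sub>L c k l))" by simp
    also have "\<dots> = id_blinfun \<boxtimes> (\<Sum>k<n. V i k o\<^sub>L c k l)"
      by (rule tn.op_tensor_sum_right[symmetric]) (auto intro!: M_bop M_comp V cM(1) il)
    finally show "(\<Sum>j<n. (\<Sum>k<n. V k j \<boxtimes> V i k) o\<^sub>L \<Delta> (c j l)) = (if i = l then id_blinfun else 0)"
      by (simp add: Vc il)
  qed (use ij in auto)
  then show ?thesis by simp
qed

text \<open>Since \<open>1 \<otimes> V = \<Delta>(V)(c \<otimes> 1)\<close> for \<open>V = c\<^sup>-\<^sup>1\<close>, slicing \<open>\<Delta>(y)(1 \<otimes> V\<^sub>i\<^sub>j)\<close> with the Haar state gives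
  \<open>\<Sum>k. h(y V\<^sub>i\<^sub>k) c\<^sub>k\<^sub>j\<close>, and slices of \<open>\<Delta>(y)\<close> with \<open>y \<in> A\<close> lie in \<open>A\<close>.\<close>

lemma corep_inverse_slice_in_A:
  fixes n :: nat
  assumes c: "corepresentation t M \<Delta> n c"
    and V: "\<And>i j. i < n \<Longrightarrow> j < n \<Longrightarrow> V i j \<in> M"
    and Vc: "\<And>i j. i < n \<Longrightarrow> j < n \<Longrightarrow> (\<Sum>k<n. V i k o\<^sub>L c k j) = (if i = j then id_blinfun else 0)"
    and cV: "\<And>i j. i < n \<Longrightarrow> j < n \<Longrightarrow> (\<Sum>k<n. c i k o\<^sub>L V k j) = (if i = j then id_blinfun else 0)"
    and ij: "i < n" "j < n" and y: "y \<in> A"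
  shows "(\<Sum>k<n. scale_op (haar \<Omega> (y o\<^sub>L V i k)) (c k j)) \<in> A"
proof -
  note cM = corep_M(1)[OF c]
  have yM: "y \<in> M" using y A_subset_M by blast
  \<comment> \<open>The identity \<open>1 \<otimes> V = \<Delta>(V)(c \<otimes> 1)\<close> evaluated
    at \<open>t \<alpha> \<Omega>\<close>.\<close>
  have tV: "(\<Sum>k<n. \<Delta> (V i k) (t (c k j \<alpha>) \<Omega>)) = t \<alpha> (V i j \<Omega>)" for \<alpha>
  proof -
    have "(\<Sum>k<n. \<Delta> (V i k) (t (c k j \<alpha>) \<Omega>)) = (\<Sum>k<n. \<Sum>m<n. t ((V m k o\<^sub>L c k j) \<alpha>) (V i m \<Omega>))"
      using ij by (intro sum.cong refl)
        (simp add: corep_inverse_Delta[OF c V Vc cV] blinfun.sum_left tn.op_tensor_apply M_bop V)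
    also have "\<dots> = (\<Sum>m<n. \<Sum>k<n. t ((V m k o\<^sub>L c k j) \<alpha>) (V i m \<Omega>))"
      by (rule sum.swap)
    also have "\<dots> = (\<Sum>m<n. t ((\<Sum>k<n. V m k o\<^sub>L c k j) \<alpha>) (V i m \<Omega>))"
      by (simp only: tn.sum_left blinfun.sum_left)
    also have "\<dots> = (\<Sum>m<n. if m = j then t \<alpha> (V i j \<Omega>) else 0)"
      using ij by (intro sum.cong refl) (auto simp: Vc)
    finally show ?thesis using ij by simp
  qed
  have "tn.slice (V i j \<Omega>) \<Omega> (\<Delta> y) = (\<Sum>k<n. scale_op (haar \<Omega> (y o\<^sub>L V i k)) (c k j))"
  proof (rule op_eqI)
    fix \<alpha> \<beta>
    have "cinner (tn.slice (V i j \<Omega>) \<Omega> (\<Delta> y) \<alpha>) \<beta>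
        = (\<Sum>k<n. cinner (\<Delta> (y o\<^sub>L V i k) (t (c k j \<alpha>) \<Omega>)) (t \<beta> \<Omega>))"
      using ij by (simp add: tn.cinner_slice Delta_bop yM tV[symmetric] blinfun.sum_right cinner_sum_left
          Delta_comp V)
    also have "\<dots> = (\<Sum>k<n. haar \<Omega> (y o\<^sub>L V i k) * cinner (c k j \<alpha>) \<beta>)"
      using ij by (intro sum.cong refl left_invariant M_comp yM V) auto
    finally show "cinner (tn.slice (V i j \<Omega>) \<Omega> (\<Delta> y) \<alpha>) \<beta>
        = cinner ((\<Sum>k<n. scale_op (haar \<Omega> (y o\<^sub>L V i k)) (c k j)) \<alpha>) \<beta>"
      by (simp add: blinfun.sum_left cinner_simps)
  qed
  moreover have "tn.slice (V i j \<Omega>) \<Omega> (\<Delta> y) \<in> A"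
    using coproduct_C y
    by (intro tn.slice_min_tensor[OF A_bop A_subspace A_closed A_bop] Delta_bop yM) auto
  ultimately show ?thesis by simp
qed

text \<open>The slices place combinations of the entries of a column in \<open>A\<close>, with
  coefficients against vectors \<open>a \<Omega>\<close>. Cyclicity of \<open>\<Omega>\<close> and
  closedness of \<open>A\<close> extend this to all vectors; for the vectors
  \<open>V i l \<Omega>\<close> the coefficients, summed over \<open>i\<close>, form a Gram matrix,
  and inverting it isolates each entry.\<close>

lemma corep_entries_in_A:
  fixes n :: nat
  assumes c: "corepresentation t M \<Delta> n c"
    and V: "\<And>i j. i < n \<Longrightarrow> j < n \<Longrightarrow> V i j \<in> M"
    and Vc: "\<And>i j. i < n \<Longrightarrow> j < n \<Longrightarrow> (\<Sum>k<n. V i k o\<^sub>L c k j) = (if i = j then id_blinfun else 0)"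
    and cV: "\<And>i j. i < n \<Longrightarrow> j < n \<Longrightarrow> (\<Sum>k<n. c i k o\<^sub>L V k j) = (if i = j then id_blinfun else 0)"
    and mj: "m < n" "j < n"
  shows "c m j \<in> A"
proof -
  note cM = corep_M(1)[OF c]
  have in_A: "(\<Sum>k<n. scale_op (cinner (V i k \<Omega>) \<zeta>) (c k j)) \<in> A" if i: "i < n" for i \<zeta>
  proof -
    let ?F = "\<lambda>\<zeta>. \<Sum>k<n. scale_op (cinner (V i k \<Omega>) \<zeta>) (c k j)"
    have "continuous_on UNIV ?F"
      by (intro continuous_on_sum bounded_linear.continuous_on[OF bounded_linear_scale_op]
          bounded_linear.continuous_on[OF bounded_linear_cinner_right] continuous_on_id)
    then have "closed (?F -` A)" by (rule closed_vimage[OF A_closed])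
    moreover have "{blinfun_apply a \<Omega> | a. a \<in> A} \<subseteq> ?F -` A"
    proof (clarsimp)
      fix a assume a: "a \<in> A"
      have ab: "a \<in> bop" using a A_bop by blast
      \<comment> \<open>The slice lemma is used with \<open>y = adj a\<close>, so that the Haar
        coefficient becomes an inner product with \<open>a \<Omega>\<close>.\<close>
      have "haar \<Omega> (adj a o\<^sub>L V i k) = cinner (V i k \<Omega>) (a \<Omega>)" for k
        by (simp add: haar_def cinner_adj_left ab)
      then show "?F (a \<Omega>) \<in> A"
        using corep_inverse_slice_in_A[OF c V Vc cV i mj(2) A_adj[OF a]] by simp
    qed
    ultimately have "closure {blinfun_apply a \<Omega> | a. a \<in> A} \<subseteq> ?F -` A"
      by (rule closure_minimal[rotated])
    then show ?thesis unfolding cyclic by blast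
  qed
  have "\<exists>H. \<forall>i<n. \<forall>j<n.
    (\<Sum>k<n. (\<Sum>l<n. cinner (V l k \<Omega>) (V l i \<Omega>)) * H k j) = (if i = j then 1 else 0) \<and>
    (\<Sum>k<n. H i k * (\<Sum>l<n. cinner (V l j \<Omega>) (V l k \<Omega>))) = (if i = j then 1 else 0)"
  proof (rule gram_inverse_exists)
    fix u :: "nat \<Rightarrow> complex" and r
    assume u: "\<And>i. i < n \<Longrightarrow> (\<Sum>k<n. u k *\<^sub>C V i k \<Omega>) = 0" and r: "r < n"
    have 0: "(\<Sum>k<n. scale_op (u k) (V i k)) = 0" if "i < n" for i
      by (rule separating) (use u that V in \<open>auto simp: blinfun.sum_left intro!: M_sum M_scale\<close>)
    \<comment> \<open>Multiplying by \<open>c\<close> undoes \<open>V\<close> and leaves the scalar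
      \<open>u r\<close>.\<close>
    have "(\<Sum>i<n. c r i o\<^sub>L (\<Sum>k<n. scale_op (u k) (V i k))) = (\<Sum>i<n. \<Sum>k<n. scale_op (u k) (c r i o\<^sub>L V i k))"
      using r by (intro sum.cong refl) (simp add: comp_sum_right scale_op_comp_right cM M_bop)
    also have "\<dots> = (\<Sum>k<n. scale_op (u k) (\<Sum>i<n. c r i o\<^sub>L V i k))"
      by (subst sum.swap) (simp add: ops.scale_sum_right)
    also have "\<dots> = (\<Sum>k<n. if k = r then scale_op (u r) id_blinfun else 0)"
      using r by (intro sum.cong refl) (auto simp: cV)
    finally have "scale_op (u r) id_blinfun = (0 :: 'h \<Rightarrow>\<^sub>L 'h)"
      using r by (simp add: 0)
    then have "cinner (scale_op (u r) id_blinfun \<Omega>) \<Omega> = 0" by simp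
    then show "u r = 0" by (simp add: cinner_simps cinner_Omega)
  qed
  then obtain H where H: "\<And>i j. i < n \<Longrightarrow> j < n \<Longrightarrow>
    (\<Sum>k<n. H i k * (\<Sum>l<n. cinner (V l j \<Omega>) (V l k \<Omega>))) = (if i = j then 1 else 0)" by blast
  define s where "s l = (\<Sum>i<n. \<Sum>k<n. scale_op (cinner (V i k \<Omega>) (V i l \<Omega>)) (c k j))" for l
  have s: "s l = (\<Sum>k<n. scale_op (\<Sum>i<n. cinner (V i k \<Omega>) (V i l \<Omega>)) (c k j))" for l
    unfolding s_def by (subst sum.swap) (simp add: ops.scale_sum_left)
  have "(\<Sum>l<n. scale_op (H m l) (s l)) = (\<Sum>l<n. \<Sum>k<n. scale_op (H m l * (\<Sum>i<n. cinner (V i k \<Omega>) (V i l \<Omega>))) (c k j))"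
    by (simp add: s ops.scale_sum_right)
  also have "\<dots> = (\<Sum>k<n. scale_op (\<Sum>l<n. H m l * (\<Sum>i<n. cinner (V i k \<Omega>) (V i l \<Omega>))) (c k j))"
    by (subst sum.swap) (simp add: ops.scale_sum_left)
  also have "\<dots> = (\<Sum>k<n. if k = m then c m j else 0)"
    using mj by (intro sum.cong refl) (auto simp: H)
  finally have "(\<Sum>l<n. scale_op (H m l) (s l)) = c m j" using mj by simp
  moreover have "(\<Sum>l<n. scale_op (H m l) (s l)) \<in> A"
    unfolding s_def
    by (intro ops.subspace_sum[OF A_subspace] ops.subspace_scale[OF A_subspace] in_A) auto
  ultimately show ?thesis by simp
qed

section \<open>The corepresentation attached to a finite-rank coproduct\<close>

lemma slice_Delta_M:
  assumes "x \<in> M"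
  shows "tn.slice \<eta> \<eta>' (\<Delta> x) \<in> M"
proof -
  \<comment> \<open>\<open>M\<close> is a bicommutant, so it contains its own bicommutant, where the
    slices of \<open>\<Delta> x\<close> lie.\<close>
  have "commutant A \<subseteq> commutant M"
    unfolding L_infty_def by (rule subset_bicommutant[OF commutant_A_bop])
  then have "commutant (commutant M) \<subseteq> M"
    using commutant_antimono unfolding L_infty_def by blast
  then show ?thesis
    using tn.slice_vn_tensor[OF M_subset_bop M_subset_bop Delta_vn_tensor[OF assms]] by blast
qed

text \<open>Since \<open>\<Omega>\<close> separates \<open>M\<close>, independence of the operators
  passes to the vectors \<open>a i \<Omega>\<close>.\<close>

lemma dual_vectors_of_independent:
  assumes "op_independent n a" "\<And>i. i < n \<Longrightarrow> a i \<in> M"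
  shows "\<exists>y. \<forall>i<n. \<forall>j<n. cinner (a i \<Omega>) (y j) = (if i = j then 1 else 0)"
proof (rule dual_vectors_exist)
  fix v i assume v: "(\<Sum>i<n. v i *\<^sub>C a i \<Omega>) = 0" and i: "i < n"
  have "(\<Sum>i<n. scale_op (v i) (a i)) = 0"
    by (rule separating) (use v assms(2) in \<open>auto simp: blinfun.sum_left intro!: M_sum M_scale\<close>)
  then show "v i = 0" using assms(1) i unfolding op_independent_def by blast
qed

text \<open>The matrix \<open>c\<close> is read off from the second leg of
  \<open>\<Delta> (b j)\<close>, paired with the functional dual to \<open>b k\<close>.
  Coassociativity then gives the formula for \<open>a\<close>; pairing its first leg with
  functionals dual to the \<open>a k\<close> recovers \<open>c\<close>, and from this follow the
  formulas for \<open>b\<close> and \<open>c\<close>.\<close>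

lemma corep_of_finite_rank:
  assumes x: "x \<in> M" and ab: "\<And>i. i < n \<Longrightarrow> a i \<in> M \<and> b i \<in> M"
    and \<Delta>x: "\<Delta> x = (\<Sum>i<n. a i \<boxtimes> b i)" and ind: "op_independent n a" "op_independent n b"
  obtains c where "corepresentation t M \<Delta> n c"
    "\<And>m. m < n \<Longrightarrow> \<Delta> (a m) = (\<Sum>j<n. a j \<boxtimes> c j m)"
    "\<And>m. m < n \<Longrightarrow> \<Delta> (b m) = (\<Sum>k<n. c m k \<boxtimes> b k)"
proof -
  from ab have a: "\<And>i. i < n \<Longrightarrow> a i \<in> M" and b: "\<And>i. i < n \<Longrightarrow> b i \<in> M" by auto
  obtain \<theta> where \<theta>: "\<And>i j. i < n \<Longrightarrow> j < n \<Longrightarrow> cinner (a i \<Omega>) (\<theta> j) = (if i = j then 1 else 0)"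
    using dual_vectors_of_independent[OF ind(1) a] by blast
  obtain \<eta> where \<eta>: "\<And>i j. i < n \<Longrightarrow> j < n \<Longrightarrow> cinner (b i \<Omega>) (\<eta> j) = (if i = j then 1 else 0)"
    using dual_vectors_of_independent[OF ind(2) b] by blast
  define c where "c j k = tn.slice \<Omega> (\<eta> k) (\<Delta> (b j))" for j k
  have cM: "c j k \<in> M" if "j < n" for j k
    unfolding c_def by (rule slice_Delta_M[OF b[OF that]])
  have c: "cinner (c j k \<alpha>) \<beta> = cinner (\<Delta> (b j) (t \<alpha> \<Omega>)) (t \<beta> (\<eta> k))" if "j < n" for j k \<alpha> \<beta>
    unfolding c_def using that by (intro tn.cinner_slice Delta_bop b)
  have delta: "(\<Sum>i<n. f i * (if i = m then 1 else 0)) = f m"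
    "(\<Sum>i<n. (if i = m then 1 else 0) * f i) = f m" if "m < n" for f :: "nat \<Rightarrow> complex" and m
  proof -
    have "(\<Sum>i<n. f i * (if i = m then 1 else 0)) = (\<Sum>i<n. if i = m then f m else 0)"
      by (intro sum.cong) auto
    then show "(\<Sum>i<n. f i * (if i = m then 1 else 0)) = f m" using that by simp
    then show "(\<Sum>i<n. (if i = m then 1 else 0) * f i) = f m" by (simp add: mult.commute)
  qed
  have \<Delta>a: "\<Delta> (a m) = (\<Sum>j<n. a j \<boxtimes> c j m)" if m: "m < n" for m
  proof (rule tn.tensor_op_eqI)
    show "\<Delta> (a m) \<in> bop" by (intro Delta_bop a m)
    show "(\<Sum>j<n. a j \<boxtimes> c j m) \<in> bop" by (rule sum_tens_bop) (auto simp: a cM)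
    fix \<alpha> \<beta> \<alpha>' \<beta>'
    \<comment> \<open>The third-leg vectors \<open>\<Omega>\<close> and \<open>\<eta> m\<close>
      select the index \<open>m\<close> in the coassociativity identity.\<close>
    have "cinner (\<Delta> (a m) (t \<alpha> \<beta>)) (t \<alpha>' \<beta>')
        = (\<Sum>k<n. cinner (\<Delta> (a k) (t \<alpha> \<beta>)) (t \<alpha>' \<beta>') * cinner (b k \<Omega>) (\<eta> m))"
      using m by (simp add: \<eta> delta)
    also have "\<dots> = (\<Sum>k<n. cinner (a k \<alpha>) \<alpha>' * cinner (\<Delta> (b k) (t \<beta> \<Omega>)) (t \<beta>' (\<eta> m)))"
      by (rule coassociative_form[OF x ab \<Delta>x])
    also have "\<dots> = cinner ((\<Sum>j<n. a j \<boxtimes> c j m) (t \<alpha> \<beta>)) (t \<alpha>' \<beta>')"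
      by (subst cinner_sum_tens) (auto simp: a cM c)
    finally show "cinner (\<Delta> (a m) (t \<alpha> \<beta>)) (t \<alpha>' \<beta>')
        = cinner ((\<Sum>j<n. a j \<boxtimes> c j m) (t \<alpha> \<beta>)) (t \<alpha>' \<beta>')" .
  qed
  \<comment> \<open>The same matrix also arises from the first leg of the
    \<open>\<Delta> (a k)\<close>.\<close>
  have slice_a: "cinner (\<Delta> (a k) (t \<Omega> \<beta>)) (t (\<theta> m) \<beta>') = cinner (c m k \<beta>) \<beta>'"
    if "m < n" "k < n" for m k \<beta> \<beta>'
    unfolding \<Delta>a[OF that(2)] by (subst cinner_sum_tens) (use that in \<open>auto simp: a cM \<theta> delta\<close>)
  have \<Delta>b: "\<Delta> (b m) = (\<Sum>k<n. c m k \<boxtimes> b k)" if m: "m < n" for m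
  proof (rule tn.tensor_op_eqI)
    show "\<Delta> (b m) \<in> bop" by (intro Delta_bop b m)
    show "(\<Sum>k<n. c m k \<boxtimes> b k) \<in> bop" by (rule sum_tens_bop) (auto simp: b cM m)
    fix \<beta> \<gamma> \<beta>' \<gamma>'
    have "cinner (\<Delta> (b m) (t \<beta> \<gamma>)) (t \<beta>' \<gamma>')
        = (\<Sum>k<n. cinner (a k \<Omega>) (\<theta> m) * cinner (\<Delta> (b k) (t \<beta> \<gamma>)) (t \<beta>' \<gamma>'))"
      using m by (simp add: \<theta> delta)
    also have "\<dots> = (\<Sum>k<n. cinner (\<Delta> (a k) (t \<Omega> \<beta>)) (t (\<theta> m) \<beta>') * cinner (b k \<gamma>) \<gamma>')"
      by (rule coassociative_form[OF x ab \<Delta>x, symmetric])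
    also have "\<dots> = cinner ((\<Sum>k<n. c m k \<boxtimes> b k) (t \<beta> \<gamma>)) (t \<beta>' \<gamma>')"
      by (subst cinner_sum_tens) (auto simp: b cM m slice_a)
    finally show "cinner (\<Delta> (b m) (t \<beta> \<gamma>)) (t \<beta>' \<gamma>')
        = cinner ((\<Sum>k<n. c m k \<boxtimes> b k) (t \<beta> \<gamma>)) (t \<beta>' \<gamma>')" .
  qed
  \<comment> \<open>Coassociativity is now applied to \<open>a m\<close> in place of
    \<open>x\<close>, its coproduct having finite rank by \<open>\<Delta>a\<close>.\<close>
  have \<Delta>c: "\<Delta> (c i m) = (\<Sum>k<n. c i k \<boxtimes> c k m)" if im: "i < n" "m < n" for i m
  proof (rule tn.tensor_op_eqI)
    show "\<Delta> (c i m) \<in> bop" by (intro Delta_bop cM im)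
    show "(\<Sum>k<n. c i k \<boxtimes> c k m) \<in> bop" by (rule sum_tens_bop) (auto simp: cM im)
    fix \<beta> \<gamma> \<beta>' \<gamma>'
    have "cinner (\<Delta> (c i m) (t \<beta> \<gamma>)) (t \<beta>' \<gamma>')
        = (\<Sum>k<n. cinner (a k \<Omega>) (\<theta> i) * cinner (\<Delta> (c k m) (t \<beta> \<gamma>)) (t \<beta>' \<gamma>'))"
      using im by (simp add: \<theta> delta)
    also have "\<dots> = (\<Sum>k<n. cinner (\<Delta> (a k) (t \<Omega> \<beta>)) (t (\<theta> i) \<beta>') * cinner (c k m \<gamma>) \<gamma>')"
      by (rule coassociative_form[OF a[OF im(2)] _ \<Delta>a[OF im(2)], symmetric]) (simp add: a cM)
    also have "\<dots> = cinner ((\<Sum>k<n. c i k \<boxtimes> c k m) (t \<beta> \<gamma>)) (t \<beta>' \<gamma>')"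
      by (subst cinner_sum_tens) (auto simp: cM im slice_a)
    finally show "cinner (\<Delta> (c i m) (t \<beta> \<gamma>)) (t \<beta>' \<gamma>')
        = cinner ((\<Sum>k<n. c i k \<boxtimes> c k m) (t \<beta> \<gamma>)) (t \<beta>' \<gamma>')" .
  qed
  show ?thesis
    by (rule that[OF _ \<Delta>a \<Delta>b]) (auto simp: corepresentation_def cM \<Delta>c)
qed

text \<open>If \<open>c v = 0\<close>, then \<open>\<Delta>\<close> kills the combination of the
  \<open>a m\<close> with coefficients \<open>v\<close>, so injectivity and independence give
  \<open>v = 0\<close>. The formula for \<open>b\<close> handles the transpose in the same
  way.\<close>

lemma finite_rank_corep_nondegenerate:
  assumes ab: "\<And>i. i < n \<Longrightarrow> a i \<in> M \<and> b i \<in> M" and ind: "op_independent n a" "op_independent n b"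
    and cM: "\<And>i j. i < n \<Longrightarrow> j < n \<Longrightarrow> c i j \<in> M"
    and \<Delta>a: "\<And>m. m < n \<Longrightarrow> \<Delta> (a m) = (\<Sum>j<n. a j \<boxtimes> c j m)"
    and \<Delta>b: "\<And>m. m < n \<Longrightarrow> \<Delta> (b m) = (\<Sum>k<n. c m k \<boxtimes> b k)"
  shows "nondegenerate n c" "nondegenerate n (\<lambda>i j. c j i)"
proof -
  have bop: "a i \<in> bop" "b i \<in> bop" if "i < n" for i using ab[OF that] M_bop by auto
  show "nondegenerate n c" unfolding nondegenerate_def
  proof (intro allI impI)
    fix v i assume v: "\<forall>i<n. (\<Sum>j<n. scale_op (v j) (c i j)) = 0" and i: "i < n"
    have "\<Delta> (\<Sum>m<n. scale_op (v m) (a m)) = (\<Sum>m<n. \<Sum>j<n. a j \<boxtimes> scale_op (v m) (c j m))"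
      by (subst Delta_sum) (auto simp: ab M_scale Delta_scale \<Delta>a ops.scale_sum_right
          tn.op_tensor_scale_right bop cM M_bop intro!: sum.cong)
    also have "\<dots> = (\<Sum>j<n. \<Sum>m<n. a j \<boxtimes> scale_op (v m) (c j m))" by (rule sum.swap)
    also have "\<dots> = (\<Sum>j<n. a j \<boxtimes> (\<Sum>m<n. scale_op (v m) (c j m)))"
      by (intro sum.cong refl tn.op_tensor_sum_right[symmetric]) (auto simp: bop cM M_bop scale_bop)
    also have "\<dots> = 0" using v by (simp add: bop)
    finally have "(\<Sum>m<n. scale_op (v m) (a m)) = 0"
      by (intro Delta_injective M_sum M_scale) (auto simp: ab)
    then show "v i = 0" using ind(1) i unfolding op_independent_def by blast
  qed
  show "nondegenerate n (\<lambda>i j. c j i)" unfolding nondegenerate_def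
  proof (intro allI impI)
    fix v i assume v: "\<forall>i<n. (\<Sum>j<n. scale_op (v j) (c j i)) = 0" and i: "i < n"
    have "\<Delta> (\<Sum>m<n. scale_op (v m) (b m)) = (\<Sum>m<n. \<Sum>k<n. scale_op (v m) (c m k) \<boxtimes> b k)"
      by (subst Delta_sum) (auto simp: ab M_scale Delta_scale \<Delta>b ops.scale_sum_right
          tn.op_tensor_scale_left bop cM M_bop intro!: sum.cong)
    also have "\<dots> = (\<Sum>k<n. \<Sum>m<n. scale_op (v m) (c m k) \<boxtimes> b k)" by (rule sum.swap)
    also have "\<dots> = (\<Sum>k<n. (\<Sum>m<n. scale_op (v m) (c m k)) \<boxtimes> b k)"
      by (intro sum.cong refl tn.op_tensor_sum_left[symmetric]) (auto simp: bop cM M_bop scale_bop)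
    also have "\<dots> = 0" using v by (simp add: bop)
    finally have "(\<Sum>m<n. scale_op (v m) (b m)) = 0"
      by (intro Delta_injective M_sum M_scale) (auto simp: ab)
    then show "v i = 0" using ind(2) i unfolding op_independent_def by blast
  qed
qed

section \<open>Scalars from invariance and the recovery of \<open>x\<close>\<close>

text \<open>Slicing the second leg of \<open>\<Delta> z\<close> with the Haar state gives
  \<open>z\<close> by hypothesis and a scalar by invariance.\<close>

lemma scalar_of_Delta_left:
  assumes z: "z \<in> M" "\<Delta> z = z \<boxtimes> id_blinfun"
  shows "z = scale_op (haar \<Omega> z) id_blinfun"
proof (rule op_eqI)
  fix \<xi> \<eta>
  show "cinner (z \<xi>) \<eta> = cinner (scale_op (haar \<Omega> z) id_blinfun \<xi>) \<eta>"
    using left_invariant[OF z(1), of \<xi> \<eta>] z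
    by (simp add: tn.op_tensor_apply M_bop tn.cinner_t cinner_Omega cinner_simps)
qed

lemma scalar_of_Delta_right:
  assumes z: "z \<in> M" "\<Delta> z = id_blinfun \<boxtimes> z"
  shows "z = scale_op (haar \<Omega> z) id_blinfun"
proof (rule op_eqI)
  fix \<xi> \<eta>
  show "cinner (z \<xi>) \<eta> = cinner (scale_op (haar \<Omega> z) id_blinfun \<xi>) \<eta>"
    using right_invariant[OF z(1), of \<xi> \<eta>] z
    by (simp add: tn.op_tensor_apply M_bop tn.cinner_t cinner_Omega cinner_simps)
qed

text \<open>The row \<open>z = a c\<^sup>-\<^sup>1\<close> satisfies \<open>\<Delta>(z) = z \<otimes> 1\<close> and the column \<open>w = c\<^sup>-\<^sup>1 b\<close> satisfies
  \<open>\<Delta>(w) = 1 \<otimes> w\<close>, so both are scalar by invariance of the Haar state; this replaces the counit,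
  which need not be bounded.\<close>

lemma finite_rank_matrix_coefficient:
  fixes n :: nat
  assumes x: "x \<in> M" and ab: "\<And>i. i < n \<Longrightarrow> a i \<in> M \<and> b i \<in> M"
    and \<Delta>x: "\<Delta> x = (\<Sum>i<n. a i \<boxtimes> b i)"
    and c: "corepresentation t M \<Delta> n c"
    and \<Delta>a: "\<And>m. m < n \<Longrightarrow> \<Delta> (a m) = (\<Sum>j<n. a j \<boxtimes> c j m)"
    and \<Delta>b: "\<And>m. m < n \<Longrightarrow> \<Delta> (b m) = (\<Sum>k<n. c m k \<boxtimes> b k)"
    and V: "\<And>i j. i < n \<Longrightarrow> j < n \<Longrightarrow> V i j \<in> M"
    and Vc: "\<And>i j. i < n \<Longrightarrow> j < n \<Longrightarrow> (\<Sum>k<n. V i k o\<^sub>L c k j) = (if i = j then id_blinfun else 0)"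
    and cV: "\<And>i j. i < n \<Longrightarrow> j < n \<Longrightarrow> (\<Sum>k<n. c i k o\<^sub>L V k j) = (if i = j then id_blinfun else 0)"
  shows "\<exists>z w. x = (\<Sum>i<n. \<Sum>j<n. scale_op (z i * w j) (c i j))"
proof -
  note cM = corep_M(1)[OF c] and \<Delta>c = corep_M(2)[OF c]
  note \<Delta>V = corep_inverse_Delta[OF c V Vc cV]
  have a: "a i \<in> M" and b: "b i \<in> M" if "i < n" for i using ab[OF that] by auto
  define z where "z j = (\<Sum>k<n. a k o\<^sub>L V k j)" for j
  define w where "w j = (\<Sum>k<n. V j k o\<^sub>L b k)" for j
  have zM: "z j \<in> M" if "j < n" for j
    unfolding z_def using that by (intro M_sum M_comp a V) auto
  have wM: "w j \<in> M" if "j < n" for j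
    unfolding w_def using that by (intro M_sum M_comp b V) auto
  have "\<Delta> (z j) = z j \<boxtimes> id_blinfun" if j: "j < n" for j
  proof -
    have "\<Delta> (z j) = (\<Sum>k<n. \<Delta> (a k o\<^sub>L V k j))"
      unfolding z_def by (rule Delta_sum) (use j in \<open>auto intro: M_comp a V\<close>)
    also have "\<dots> = (\<Sum>k<n. \<Sum>l<n. \<Sum>m<n. (a l o\<^sub>L V m j) \<boxtimes> (c l k o\<^sub>L V k m))"
      by (intro sum.cong refl, simp add: Delta_comp a V \<Delta>a \<Delta>V comp_sum_left comp_sum_right
          tn.op_tensor_comp M_bop cM j) (rule sum.swap)
    also have "\<dots> = (\<Sum>l<n. \<Sum>k<n. \<Sum>m<n. (a l o\<^sub>L V m j) \<boxtimes> (c l k o\<^sub>L V k m))"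
      by (rule sum.swap)
    also have "\<dots> = (\<Sum>l<n. \<Sum>m<n. \<Sum>k<n. (a l o\<^sub>L V m j) \<boxtimes> (c l k o\<^sub>L V k m))"
      by (rule sum.cong[OF refl]) (rule sum.swap)
    \<comment> \<open>The sum over \<open>k\<close> collapses \<open>c V\<close> in the second
      leg.\<close>
    also have "\<dots> = (\<Sum>l<n. \<Sum>m<n. if m = l then (a l o\<^sub>L V l j) \<boxtimes> id_blinfun else 0)"
    proof (intro sum.cong refl)
      fix l m assume "l \<in> {..<n}" "m \<in> {..<n}"
      then have lm: "l < n" "m < n" by auto
      have "(\<Sum>k<n. (a l o\<^sub>L V m j) \<boxtimes> (c l k o\<^sub>L V k m)) = (a l o\<^sub>L V m j) \<boxtimes> (\<Sum>k<n. c l k o\<^sub>L V k m)"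
        by (rule tn.op_tensor_sum_right[symmetric]) (auto intro!: M_bop M_comp a V cM lm j)
      then show "(\<Sum>k<n. (a l o\<^sub>L V m j) \<boxtimes> (c l k o\<^sub>L V k m))
          = (if m = l then (a l o\<^sub>L V l j) \<boxtimes> id_blinfun else 0)"
        by (auto simp: cV lm j comp_bop a V M_bop)
    qed
    also have "\<dots> = (\<Sum>l<n. (a l o\<^sub>L V l j) \<boxtimes> id_blinfun)" by simp
    also have "\<dots> = z j \<boxtimes> id_blinfun"
      unfolding z_def by (rule tn.op_tensor_sum_left[symmetric]) (auto intro!: M_bop M_comp a V j M_id)
    finally show ?thesis .
  qed
  then have z: "z j = scale_op (haar \<Omega> (z j)) id_blinfun" if "j < n" for j
    using that by (intro scalar_of_Delta_left zM)
  have "\<Delta> (w j) = id_blinfun \<boxtimes> w j" if j: "j < n" for j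
  proof -
    have "\<Delta> (w j) = (\<Sum>k<n. \<Delta> (V j k o\<^sub>L b k))"
      unfolding w_def by (rule Delta_sum) (use j in \<open>auto intro: M_comp b V\<close>)
    also have "\<dots> = (\<Sum>k<n. \<Sum>l<n. \<Sum>m<n. (V l k o\<^sub>L c k m) \<boxtimes> (V j l o\<^sub>L b m))"
      by (intro sum.cong refl, simp add: Delta_comp b V \<Delta>b \<Delta>V comp_sum_left comp_sum_right
          tn.op_tensor_comp M_bop cM j) (rule sum.swap)
    also have "\<dots> = (\<Sum>l<n. \<Sum>k<n. \<Sum>m<n. (V l k o\<^sub>L c k m) \<boxtimes> (V j l o\<^sub>L b m))"
      by (rule sum.swap)
    also have "\<dots> = (\<Sum>l<n. \<Sum>m<n. \<Sum>k<n. (V l k o\<^sub>L c k m) \<boxtimes> (V j l o\<^sub>L b m))"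
      by (rule sum.cong[OF refl]) (rule sum.swap)
    \<comment> \<open>Here \<open>V c\<close> collapses in the first leg.\<close>
    also have "\<dots> = (\<Sum>l<n. \<Sum>m<n. if m = l then id_blinfun \<boxtimes> (V j l o\<^sub>L b l) else 0)"
    proof (intro sum.cong refl)
      fix l m assume "l \<in> {..<n}" "m \<in> {..<n}"
      then have lm: "l < n" "m < n" by auto
      have "(\<Sum>k<n. (V l k o\<^sub>L c k m) \<boxtimes> (V j l o\<^sub>L b m)) = (\<Sum>k<n. V l k o\<^sub>L c k m) \<boxtimes> (V j l o\<^sub>L b m)"
        by (rule tn.op_tensor_sum_left[symmetric]) (auto intro!: M_bop M_comp b V cM lm j)
      then show "(\<Sum>k<n. (V l k o\<^sub>L c k m) \<boxtimes> (V j l o\<^sub>L b m))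
          = (if m = l then id_blinfun \<boxtimes> (V j l o\<^sub>L b l) else 0)"
        by (auto simp: Vc lm j comp_bop b V M_bop)
    qed
    also have "\<dots> = (\<Sum>l<n. id_blinfun \<boxtimes> (V j l o\<^sub>L b l))" by simp
    also have "\<dots> = id_blinfun \<boxtimes> w j"
      unfolding w_def by (rule tn.op_tensor_sum_right[symmetric]) (auto intro!: M_bop M_comp b V j M_id)
    finally show ?thesis .
  qed
  then have w: "w j = scale_op (haar \<Omega> (w j)) id_blinfun" if "j < n" for j
    using that by (intro scalar_of_Delta_right wM)
  define \<kappa> where "\<kappa> j = haar \<Omega> (z j)" for j
  define \<mu> where "\<mu> j = haar \<Omega> (w j)" for j
  \<comment> \<open>Multiplying \<open>z = a V\<close> by \<open>c\<close> on the right recovers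
    \<open>a\<close> with scalar coefficients; \<open>b_eq\<close> does the same for
    \<open>w = V b\<close> on the left.\<close>
  have a_eq: "a l = (\<Sum>j<n. scale_op (\<kappa> j) (c j l))" if l: "l < n" for l
  proof -
    have "(\<Sum>j<n. scale_op (\<kappa> j) (c j l)) = (\<Sum>j<n. scale_op (\<kappa> j) id_blinfun o\<^sub>L c j l)"
      by (simp add: scale_op_comp_left)
    also have "\<dots> = (\<Sum>j<n. z j o\<^sub>L c j l)"
      unfolding \<kappa>_def by (intro sum.cong refl) (use z in simp)
    also have "\<dots> = (\<Sum>k<n. \<Sum>j<n. a k o\<^sub>L (V k j o\<^sub>L c j l))"
      by (simp add: z_def comp_sum_left comp_assoc) (rule sum.swap)
    also have "\<dots> = (\<Sum>k<n. if k = l then a l else 0)"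
      unfolding comp_sum_right[symmetric] by (intro sum.cong refl) (use l in \<open>auto simp: Vc\<close>)
    finally show ?thesis using l by simp
  qed
  have b_eq: "b i = (\<Sum>j<n. scale_op (\<mu> j) (c i j))" if i: "i < n" for i
  proof -
    have "(\<Sum>j<n. scale_op (\<mu> j) (c i j)) = (\<Sum>j<n. c i j o\<^sub>L scale_op (\<mu> j) id_blinfun)"
      by (intro sum.cong refl) (simp add: scale_op_comp_right cM M_bop i)
    also have "\<dots> = (\<Sum>j<n. c i j o\<^sub>L w j)"
      unfolding \<mu>_def by (intro sum.cong refl) (use w in simp)
    also have "\<dots> = (\<Sum>k<n. \<Sum>j<n. (c i j o\<^sub>L V j k) o\<^sub>L b k)"
      by (simp add: w_def comp_sum_right comp_assoc) (rule sum.swap)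
    also have "\<dots> = (\<Sum>k<n. if k = i then b i else 0)"
      unfolding comp_sum_left[symmetric] by (intro sum.cong refl) (use i in \<open>auto simp: cV\<close>)
    finally show ?thesis using i by simp
  qed
  \<comment> \<open>After both substitutions the sum over \<open>k\<close> is
    \<open>\<Delta> (c i j)\<close>, and injectivity of \<open>\<Delta>\<close> identifies
    \<open>x\<close>.\<close>
  have "\<Delta> x = (\<Sum>k<n. \<Sum>i<n. \<Sum>j<n. scale_op (\<kappa> i * \<mu> j) (c i k \<boxtimes> c k j))"
    unfolding \<Delta>x
  proof (intro sum.cong refl)
    fix k assume "k \<in> {..<n}"
    then have k: "k < n" by simp
    have "a k \<boxtimes> b k = (\<Sum>i<n. scale_op (\<kappa> i) (c i k) \<boxtimes> b k)"
      unfolding a_eq[OF k] by (rule tn.op_tensor_sum_left) (auto intro!: M_bop M_scale cM b k)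
    also have "\<dots> = (\<Sum>i<n. \<Sum>j<n. scale_op (\<kappa> i) (c i k) \<boxtimes> scale_op (\<mu> j) (c k j))"
      unfolding b_eq[OF k]
      by (intro sum.cong refl tn.op_tensor_sum_right) (auto intro!: M_bop M_scale cM k)
    also have "\<dots> = (\<Sum>i<n. \<Sum>j<n. scale_op (\<kappa> i * \<mu> j) (c i k \<boxtimes> c k j))"
      by (intro sum.cong refl)
        (simp add: tn.op_tensor_scale_left tn.op_tensor_scale_right scale_bop M_bop cM k mult.commute)
    finally show "a k \<boxtimes> b k = (\<Sum>i<n. \<Sum>j<n. scale_op (\<kappa> i * \<mu> j) (c i k \<boxtimes> c k j))" .
  qed
  also have "\<dots> = (\<Sum>i<n. \<Sum>k<n. \<Sum>j<n. scale_op (\<kappa> i * \<mu> j) (c i k \<boxtimes> c k j))"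
    by (rule sum.swap)
  also have "\<dots> = (\<Sum>i<n. \<Sum>j<n. \<Sum>k<n. scale_op (\<kappa> i * \<mu> j) (c i k \<boxtimes> c k j))"
    by (rule sum.cong[OF refl]) (rule sum.swap)
  also have "\<dots> = (\<Sum>i<n. \<Sum>j<n. \<Delta> (scale_op (\<kappa> i * \<mu> j) (c i j)))"
    by (intro sum.cong refl) (simp add: Delta_scale cM \<Delta>c ops.scale_sum_right)
  also have "\<dots> = (\<Sum>i<n. \<Delta> (\<Sum>j<n. scale_op (\<kappa> i * \<mu> j) (c i j)))"
    by (intro sum.cong refl Delta_sum[symmetric] M_scale cM) auto
  also have "\<dots> = \<Delta> (\<Sum>i<n. \<Sum>j<n. scale_op (\<kappa> i * \<mu> j) (c i j))"
    by (intro Delta_sum[symmetric] M_sum M_scale cM) auto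
  finally have "x = (\<Sum>i<n. \<Sum>j<n. scale_op (\<kappa> i * \<mu> j) (c i j))"
    by (intro Delta_eq_imp_eq[OF x] M_sum M_scale cM) auto
  then show ?thesis by blast
qed

section \<open>The two inclusions\<close>

lemma P_infty_subset_AP: "P_infty t A \<Delta> \<subseteq> AP t A \<Delta>"
proof
  fix x assume "x \<in> P_infty t A \<Delta>"
  then have x: "x \<in> M" "\<Delta> x \<in> alg_tensor t M M" by (auto simp: P_infty_def)
  obtain n a b where ab: "\<And>i. i < n \<Longrightarrow> a i \<in> M \<and> b i \<in> M"
    and \<Delta>x: "\<Delta> x = (\<Sum>i<n. a i \<boxtimes> b i)" and ind: "op_independent n a" "op_independent n b"
    using alg_tensor_minimal_repr[OF M_subspace M_subset_bop tensor(1) x(2)] by blast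
  obtain c where c: "corepresentation t M \<Delta> n c"
    and \<Delta>a: "\<And>m. m < n \<Longrightarrow> \<Delta> (a m) = (\<Sum>j<n. a j \<boxtimes> c j m)"
    and \<Delta>b: "\<And>m. m < n \<Longrightarrow> \<Delta> (b m) = (\<Sum>k<n. c m k \<boxtimes> b k)"
    using corep_of_finite_rank[OF x(1) ab \<Delta>x ind] by blast
  note cM = corep_M(1)[OF c]
  note nd = finite_rank_corep_nondegenerate[OF ab ind cM \<Delta>a \<Delta>b]
  \<comment> \<open>The inverse is first found over \<open>M\<close>; it serves to show that the
    entries of \<open>c\<close> lie in \<open>A\<close>, after which invertibility over
    \<open>A\<close> follows.\<close>
  from corep_invertible[OF c nd M_subspace M_adj cM]
  obtain V where V: "\<And>i j. i < n \<Longrightarrow> j < n \<Longrightarrow> V i j \<in> M"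
    and Vc: "\<And>i j. i < n \<Longrightarrow> j < n \<Longrightarrow> (\<Sum>k<n. V i k o\<^sub>L c k j) = (if i = j then id_blinfun else 0)"
    and cV: "\<And>i j. i < n \<Longrightarrow> j < n \<Longrightarrow> (\<Sum>k<n. c i k o\<^sub>L V k j) = (if i = j then id_blinfun else 0)"
    unfolding invertible_matrix_def by blast
  note cA = corep_entries_in_A[OF c V Vc cV]
  have "admissible t A \<Delta> n c"
    unfolding admissible_def
  proof (intro conjI)
    show "corepresentation t A \<Delta> n c"
      using c cA by (auto simp: corepresentation_def)
    show "invertible_matrix A n c"
      by (rule corep_invertible[OF c nd A_subspace A_adj cA])
    show "invertible_matrix A n (\<lambda>i j. c j i)"
      by (rule corep_transpose_invertible[OF c nd A_subspace A_bop A_adj cA])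
  qed
  then have "c i j \<in> AP t A \<Delta>" if "i < n" "j < n" for i j
    unfolding AP_def using that by (intro ops.span_base) blast
  moreover obtain z w where "x = (\<Sum>i<n. \<Sum>j<n. scale_op (z i * w j) (c i j))"
    using finite_rank_matrix_coefficient[OF x(1) ab \<Delta>x c \<Delta>a \<Delta>b V Vc cV] by blast
  ultimately show "x \<in> AP t A \<Delta>"
    unfolding AP_def by (auto intro!: ops.span_sum ops.span_scale)
qed

text \<open>The corepresentation formula is itself a finite-rank expression, and
  \<open>P_infty\<close> is a subspace.\<close>

lemma AP_subset_P_infty: "AP t A \<Delta> \<subseteq> P_infty t A \<Delta>"
  unfolding AP_def
proof (rule ops.span_minimal)
  show "{U i j | U i j n. admissible t A \<Delta> n U \<and> i < n \<and> j < n} \<subseteq> P_infty t A \<Delta>"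
  proof clarify
    fix U i j n assume U: "admissible t A \<Delta> n U" and ij: "i < n" "j < n"
    then have UA: "U i j \<in> M" if "i < n" "j < n" for i j
      using that A_subset_M by (auto simp: admissible_def corepresentation_def)
    have "\<Delta> (U i j) = (\<Sum>k<n. U i k \<boxtimes> U k j)"
      using U ij by (auto simp: admissible_def corepresentation_def)
    also have "\<dots> \<in> alg_tensor t M M"
      unfolding alg_tensor_def using UA ij by (intro ops.span_sum ops.span_base) auto
    finally show "U i j \<in> P_infty t A \<Delta>" using UA[OF ij] by (simp add: P_infty_def)
  qed
  show "ops.subspace (P_infty t A \<Delta>)"
    using M_subspace
    by (auto simp: P_infty_def ops.subspace_def Delta_zero Delta_add Delta_scale alg_tensor_def
        intro: ops.span_zero ops.span_add ops.span_scale)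
qed

end

theorem theorem6p4:
  fixes t :: "'h::chilbert_space \<Rightarrow> 'h \<Rightarrow> 'k::chilbert_space"
    and tL :: "'k \<Rightarrow> 'h \<Rightarrow> 'l::chilbert_space"
    and tR :: "'h \<Rightarrow> 'k \<Rightarrow> 'l"
    and A :: "('h \<Rightarrow>\<^sub>L 'h) set"
    and \<Omega> :: 'h
    and \<Delta> :: "('h \<Rightarrow>\<^sub>L 'h) \<Rightarrow> ('k \<Rightarrow>\<^sub>L 'k)"
  assumes "compact_quantum_group t tL tR A \<Omega> \<Delta>"
  shows "P_infty t A \<Delta> = AP t A \<Delta>"
proof -
  interpret compact_quantum_group t tL tR A \<Omega> \<Delta> by fact
  show ?thesis
    by (rule subset_antisym[OF P_infty_subset_AP AP_subset_P_infty])
qed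

end
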